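(* Let $n,m\ge 1$ be integers, let $f_p:\mathbb{R}^n\times\mathbb{R}\to\mathbb{R}^n$ and $f_c:\mathbb{R}^m\times\mathbb{R}\to\mathbb{R}^m$ be continuous, let $G_p\in\mathbb{R}^{1\times n}$, and let $k_1,k_2\in\mathbb{R}$ with $k_1<k_2$. Let $$S=\{(e,u)\in\mathbb{R}^2\mid (u-k_1e)(u-k_2e)\le 0\},\qquad \mathcal{S}=\{\xi=(x,z)\in\mathbb{R}^{n+m}\mid (G_px,z_1)\in S\},$$ $$\mathcal{E}=\{0\}\times\mathbb{R}^m\subseteq\mathbb{R}^{n+m},\qquad f(\xi)=(f_p(x,z_1),f_c(z,G_px))\ \text{ for } \xi=(x,z).$$ For each initial state $\xi_0\in\mathcal{S}$ there exist $T>0$ and a Carathéodory solution $\xi:[0,T]\to\mathbb{R}^{n+m}$ with $\xi(0)=\xi_0$ to $$\dot\xi=\Pi_{\mathcal{S},\mathcal{E}}(\xi,f(\xi)).$$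
   Context: Here $z_1$ is the first component of $z\in\mathbb{R}^m$. Tangent cone: for a set $C\subseteq\mathbb{R}^N$ and $x\in C$, $T_C(x)$ is the set of all $v\in\mathbb{R}^N$ for which there exist sequences $\{x_i\}_{i\in\mathbb{N}}\subseteq C$ and $\{\tau_i\}_{i\in\mathbb{N}}$ with $\tau_i>0$, $x_i\to x$, $\tau_i\downarrow 0$, and $v=\lim_{i\to\infty}(x_i-x)/\tau_i$. Projection operator: for $\xi\in\mathcal{S}$ and $v\in\mathbb{R}^{n+m}$, $\Pi_{\mathcal{S},\mathcal{E}}(\xi,v)=\operatorname{argmin}_{w\in T_{\mathcal{S}}(\xi),\ w-v\in\mathcal{E}}\|w-v\|$ (Euclidean norm); in this setting the minimizer exists and is unique, and $\Pi_{\mathcal{S},\mathcal{E}}(\xi,v)$ denotes it. Carathéodory solution on $[0,T]$: a function $\xi:[0,T]\to\mathbb{R}^{n+m}$ that is absolutely continuous, satisfies $\dot\xi(t)=\Pi_{\mathcal{S},\mathcal{E}}(\xi(t),f(\xi(t)))$ for almost all $t\in[0,T]$, and satisfies $\xi(t)\in\mathcal{S}$ for all $t\in[0,T]$. *)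

theory Defs
  imports "HOL-Analysis.Analysis"
begin

definition tangent_cone :: "'a::real_normed_vector set \<Rightarrow> 'a \<Rightarrow> 'a set" where
  "tangent_cone C x =
     {v. \<exists>(X :: nat \<Rightarrow> 'a) (\<tau> :: nat \<Rightarrow> real).
           (\<forall>i. X i \<in> C) \<and> (\<forall>i. \<tau> i > 0) \<and>
           X \<longlonglongrightarrow> x \<and> decseq \<tau> \<and> \<tau> \<longlonglongrightarrow> 0 \<and>
           (\<lambda>i. (X i - x) /\<^sub>R \<tau> i) \<longlonglongrightarrow> v}"

(* Meaningful only where the minimizer exists and is unique. *)
definition proj_operator ::
    "'a::real_normed_vector set \<Rightarrow> 'a set \<Rightarrow> 'a \<Rightarrow> 'a \<Rightarrow> 'a" where
  "proj_operator S E \<xi> v =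
     (THE w. is_arg_min (\<lambda>w. norm (w - v)) (\<lambda>w. w \<in> tangent_cone S \<xi> \<and> w - v \<in> E) w)"

(* Absolute continuity of a function, unrelated to the library's
   absolutely_continuous, which relates two measures.
   The finite set D of pairs (c, d) is a family of nonoverlapping intervals [c, d]. *)
definition abs_continuous_on :: "real \<Rightarrow> real \<Rightarrow> (real \<Rightarrow> 'a::real_normed_vector) \<Rightarrow> bool" where
  "abs_continuous_on a b g \<longleftrightarrow>
     (\<forall>\<epsilon>>0. \<exists>\<delta>>0. \<forall>D :: (real \<times> real) set.
        finite D \<and>
        (\<forall>(c, d) \<in> D. a \<le> c \<and> c \<le> d \<and> d \<le> b) \<and>
        pairwise (\<lambda>p q. disjnt {fst p<..<snd p} {fst q<..<snd q}) D \<and>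
        (\<Sum>(c, d)\<in>D. d - c) < \<delta> \<longrightarrow>
        (\<Sum>(c, d)\<in>D. norm (g d - g c)) < \<epsilon>)"

definition caratheodory_solution ::
    "'a::real_normed_vector set \<Rightarrow> 'a set \<Rightarrow> ('a \<Rightarrow> 'a) \<Rightarrow> real \<Rightarrow> (real \<Rightarrow> 'a) \<Rightarrow> bool" where
  "caratheodory_solution S E f T \<xi> \<longleftrightarrow>
     abs_continuous_on 0 T \<xi> \<and>
     (AE t in lebesgue_on {0..T}.
        (\<xi> has_vector_derivative proj_operator S E (\<xi> t) (f (\<xi> t))) (at t within {0..T})) \<and>
     (\<forall>t\<in>{0..T}. \<xi> t \<in> S)"

(* The linear order on the index type serves only to single out the first coordinate. *)
definition first_comp :: "real ^ 'm::{finite,linorder} \<Rightarrow> real" where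
  "first_comp z = z $ Min UNIV"

definition row_apply :: "real ^ 'n ^ 1 \<Rightarrow> real ^ 'n \<Rightarrow> real" where
  "row_apply G x = (G *v x) $ 1"

definition sector :: "real \<Rightarrow> real \<Rightarrow> (real \<times> real) set" where
  "sector k\<^sub>1 k\<^sub>2 = {(e, u). (u - k\<^sub>1 * e) * (u - k\<^sub>2 * e) \<le> 0}"

(* The state space is the product type, whose norm is the Euclidean one. *)
definition sector_states ::
    "real ^ 'n ^ 1 \<Rightarrow> real \<Rightarrow> real \<Rightarrow> ((real ^ 'n) \<times> (real ^ 'm::{finite,linorder})) set" where
  "sector_states G k\<^sub>1 k\<^sub>2 = {(x, z). (row_apply G x, first_comp z) \<in> sector k\<^sub>1 k\<^sub>2}"

definition proj_directions :: "((real ^ 'n) \<times> (real ^ 'm)) set" where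
  "proj_directions = {0} \<times> UNIV"

definition closed_loop ::
    "((real ^ 'n) \<times> real \<Rightarrow> real ^ 'n) \<Rightarrow> ((real ^ 'm::{finite,linorder}) \<times> real \<Rightarrow> real ^ 'm::{finite,linorder}) \<Rightarrow> real ^ 'n ^ 1 \<Rightarrow>
     (real ^ 'n) \<times> (real ^ 'm::{finite,linorder}) \<Rightarrow> (real ^ 'n) \<times> (real ^ 'm::{finite,linorder})" where
  "closed_loop f\<^sub>p f\<^sub>c G = (\<lambda>(x, z). (f\<^sub>p (x, first_comp z), f\<^sub>c (z, row_apply G x)))"

end

theory Submission
  imports Defs "HOL-Complex_Analysis.Great_Picard"
begin

text \<open>
  The sector condition says that two linear forms \<open>p = u - k\<^sub>1 e\<close> and \<open>q = u - k\<^sub>2 e\<close> never have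
  the same strict sign on the state, where \<open>e\<close> is the plant output and \<open>u\<close> the first controller state. The allowed
  corrections change \<open>e\<close> not at all, so the projection only moves \<open>u\<close>, along the unit vector \<open>b\<close>.
  For given \<open>e\<close>, the admissible values of \<open>u\<close> form an interval between \<open>k\<^sub>1 e\<close> and \<open>k\<^sub>2 e\<close>.
  Although the state set, a double cone, is not convex, the problem is thus a sweeping process: \<open>u\<close>
  is confined to a moving interval, which shrinks to a point when \<open>e = 0\<close>.

  Solutions are limits of Euler polygons whose vertices are projected back along \<open>b\<close>
  (\<open>catch_up_scheme\<close>, \<open>polygon_limit\<close>). The right-hand side is discontinuous, so the equation itself
  cannot be passed to the limit. What does pass is weaker (\<open>reflected_curve_exists\<close>): the limit is
  the sum of a curve that follows the continuous field \<open>f\<close> and of an accumulated push \<open>\<Lambda>\<close> along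
  \<open>b\<close>, with \<open>\<Lambda>\<close> nondecreasing near times where \<open>p < 0\<close> or \<open>q < 0\<close>, and nonincreasing near times
  where \<open>p > 0\<close> or \<open>q > 0\<close>.

  This suffices for almost every time. A Lipschitz function has derivative zero at
  almost every point of its zero set (\<open>lipschitz_derivative_zero_on_zero_set\<close>). Hence at almost every
  time spent on a boundary line, the velocity is tangent to that line, and at almost every
  time spent at the vertex \<open>e = u = 0\<close> it is tangent to both. So the push rate obeys a
  complementarity law (\<open>reflected_curve_complementary_ae\<close>), and this law singles out
  exactly the minimizer in the definition of the projection (\<open>proj_operator_double_wedge\<close>). At the
  vertex, where the projected field jumps in a complicated way, the tangent cone is the wedge itself,
  and tangency to both lines already determines the push.
\<close>

section \<open>Zero sets of Lipschitz functions\<close>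

text \<open>
  Every point of a porous set lies in arbitrarily small balls that contain a hole of a fixed
  relative size. Surround the closure of the set by an open set that exceeds it by little measure.
  By Vitali's theorem, disjoint balls of this kind inside the open set cover almost all of the porous
  set; their holes lie in the excess, so the balls have small total measure as well.
\<close>

lemma porous_imp_negligible:
  fixes A :: "'a::euclidean_space set"
  assumes c: "0 < c" "c \<le> 1"
    and holes: "\<And>x d. x \<in> A \<Longrightarrow> 0 < d \<Longrightarrow>
      \<exists>y r. 0 < r \<and> r < d \<and> x \<in> cball y r \<and> ball y (c * r) \<inter> A = {}"
  shows "negligible A"
  unfolding negligible_outer_le
proof (intro allI impI)
  fix e :: real
  assume "e > 0"
  define \<epsilon> where "\<epsilon> = c ^ DIM('a) * e"
  have "\<epsilon> > 0" using c \<open>e > 0\<close> by (simp add: \<epsilon>_def)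
  have "closure A \<in> sets lebesgue" by simp
  then obtain U where U: "open U" "closure A \<subseteq> U" "emeasure lebesgue (U - closure A) < ennreal \<epsilon>"
    by (rule sets_lebesgue_outer_open[OF _ \<open>\<epsilon> > 0\<close>])
  define K where "K = {(y, r). 0 < r \<and> cball y r \<subseteq> U \<and> ball y (c * r) \<inter> A = {}}"
  have fine: "\<exists>i. i \<in> K \<and> x \<in> cball (fst i) (snd i) \<and> snd i < d" if "x \<in> A" "0 < d" for x d
  proof -
    have "x \<in> U" using that U(2) closure_subset by blast
    then obtain k where k: "k > 0" "ball x k \<subseteq> U" using U(1) open_contains_ball by blast
    have "0 < min d (k / 2)" using that k by simp
    then obtain y r where yr: "0 < r" "r < min d (k / 2)" "x \<in> cball y r" "ball y (c * r) \<inter> A = {}"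
      using holes[OF \<open>x \<in> A\<close>] by blast
    have "cball y r \<subseteq> ball x k"
    proof
      fix w assume "w \<in> cball y r"
      then have "dist x w \<le> r + r"
        using yr(3) dist_triangle[of x w y] by (simp add: dist_commute)
      then show "w \<in> ball x k" using yr(2) by simp
    qed
    then have "(y, r) \<in> K" using yr k(2) unfolding K_def by blast
    then show ?thesis using yr(2,3) by (intro exI[of _ "(y, r)"]) simp
  qed
  obtain C where C: "countable C" "C \<subseteq> K"
    and disj: "pairwise (\<lambda>i j. disjnt (cball (fst i) (snd i)) (cball (fst j) (snd j))) C"
    and neg: "negligible (A - (\<Union>i\<in>C. cball (fst i) (snd i)))"
  proof (rule Vitali_covering_theorem_cballs[of K snd A fst])
    show "0 < snd i" if "i \<in> K" for i using that by (auto simp: K_def)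
  qed (use fine in blast)+
  let ?B = "\<Union>i\<in>C. cball (fst i) (snd i)" and ?H = "\<Union>i\<in>C. ball (fst i) (c * snd i)"
  have sub: "ball (fst i) (c * snd i) \<subseteq> cball (fst i) (snd i)" if "i \<in> C" for i
  proof -
    have "c * snd i \<le> 1 * snd i"
      using that C(2) c by (intro mult_right_mono) (auto simp: K_def)
    then show ?thesis by auto
  qed
  have dB: "disjoint_family_on (\<lambda>i. cball (fst i) (snd i)) C"
    using disj unfolding disjoint_family_on_def pairwise_def disjnt_def by blast
  have dH: "disjoint_family_on (\<lambda>i. ball (fst i) (c * snd i)) C"
    unfolding disjoint_family_on_def
  proof (intro ballI impI)
    fix i j assume "i \<in> C" "j \<in> C" "i \<noteq> j"
    then show "ball (fst i) (c * snd i) \<inter> ball (fst j) (c * snd j) = {}"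
      using dB sub[of i] sub[of j] unfolding disjoint_family_on_def by blast
  qed
  have scale: "emeasure lebesgue (ball (fst i) (c * snd i))
      = ennreal (c ^ DIM('a)) * emeasure lebesgue (cball (fst i) (snd i))" if "i \<in> C" for i
  proof -
    have "snd i > 0" using that C(2) by (auto simp: K_def)
    then show ?thesis using c
      by (simp add: emeasure_ball emeasure_cball power_mult_distrib ennreal_mult[symmetric] mult_ac)
  qed
  have "emeasure lebesgue ?H = (\<integral>\<^sup>+i. emeasure lebesgue (ball (fst i) (c * snd i)) \<partial>count_space C)"
    by (rule emeasure_UN_countable[OF _ C(1) dH]) auto
  also have "\<dots> = (\<integral>\<^sup>+i. ennreal (c ^ DIM('a)) * emeasure lebesgue (cball (fst i) (snd i)) \<partial>count_space C)"
    by (rule nn_integral_cong) (simp only: space_count_space scale)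
  also have "\<dots> = ennreal (c ^ DIM('a)) * (\<integral>\<^sup>+i. emeasure lebesgue (cball (fst i) (snd i)) \<partial>count_space C)"
    by (rule nn_integral_cmult) simp
  also have "(\<integral>\<^sup>+i. emeasure lebesgue (cball (fst i) (snd i)) \<partial>count_space C) = emeasure lebesgue ?B"
    by (rule emeasure_UN_countable[OF _ C(1) dB, symmetric]) auto
  finally have HB: "emeasure lebesgue ?H = ennreal (c ^ DIM('a)) * emeasure lebesgue ?B" .
  have "?H \<subseteq> U - closure A"
  proof -
    have "ball (fst i) (c * snd i) \<inter> closure A = {}" "cball (fst i) (snd i) \<subseteq> U" if "i \<in> C" for i
    proof -
      have "ball (fst i) (c * snd i) \<inter> A = {}" "cball (fst i) (snd i) \<subseteq> U"
        using that C(2) unfolding K_def by force+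
      then show "ball (fst i) (c * snd i) \<inter> closure A = {}" "cball (fst i) (snd i) \<subseteq> U"
        by (simp_all only: open_ball open_Int_closure_eq_empty)
    qed
    then show ?thesis using sub by fast
  qed
  then have "emeasure lebesgue ?H \<le> emeasure lebesgue (U - closure A)"
    by (rule emeasure_mono) (simp add: U(1) borel_open)
  then have "ennreal (c ^ DIM('a)) * emeasure lebesgue ?B < ennreal (c ^ DIM('a)) * ennreal e"
    using U(3) c \<open>e > 0\<close> by (simp add: HB \<epsilon>_def ennreal_mult)
  then have B: "emeasure lebesgue ?B < ennreal e"
    using mult_left_mono[OF _ zero_le] not_le by blast
  have Bs: "?B \<in> sets lebesgue"
    using C(1) by (intro sets.countable_UN') auto
  have Bm: "?B \<in> lmeasurable"
    using B Bs by (intro fmeasurableI) (auto intro: less_trans)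
  show "\<exists>T. A \<subseteq> T \<and> T \<in> lmeasurable \<and> measure lebesgue T \<le> e"
  proof (intro exI conjI)
    show "A \<subseteq> ?B \<union> (A - ?B)" by blast
    show "?B \<union> (A - ?B) \<in> lmeasurable"
      using Bm negligible_imp_measurable[OF neg] by (rule fmeasurable.Un)
    have "measure lebesgue (?B \<union> (A - ?B)) = measure lebesgue ?B"
      using neg Bs by (intro measure_Un_null_set) (auto simp: negligible_iff_null_sets)
    also have "\<dots> \<le> e"
      using B Bm \<open>e > 0\<close> by (simp add: emeasure_eq_measure2 ennreal_less_iff)
    finally show "measure lebesgue (?B \<union> (A - ?B)) \<le> e" .
  qed
qed

text \<open>
  At a zero \<open>x\<close> where the derivative is not \<open>0\<close>, there are points \<open>y\<close> arbitrarily close to \<open>x\<close>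
  with \<open>norm (f y)\<close> at least a fixed fraction of the distance to \<open>x\<close>. The Lipschitz bound keeps
  \<open>f\<close> away from \<open>0\<close> on a ball around \<open>y\<close> of proportional radius, so such zeros form a
  countable union of porous sets. This replaces Lebesgue's theorem on the differentiability of
  Lipschitz functions.
\<close>

lemma lipschitz_derivative_zero_on_zero_set:
  fixes f :: "'a::euclidean_space \<Rightarrow> 'b::real_normed_vector"
  assumes lip: "L-lipschitz_on D f"
  shows "negligible {x \<in> D. f x = 0 \<and> \<not> (f has_derivative (\<lambda>_. 0)) (at x within D)}"
proof -
  define A where "A n = {x \<in> D. f x = 0 \<and>
    (\<forall>d>0. \<exists>y\<in>D. 0 < dist x y \<and> dist x y < d \<and> dist x y / real (Suc n) < norm (f y))}" for n
  have "negligible (A n)" for n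
  proof (rule porous_imp_negligible)
    define c where "c = 1 / (real (Suc n) * (L + 1))"
    have L: "L \<ge> 0" using lip lipschitz_on_nonneg by blast
    show "0 < c" using L by (simp add: c_def)
    have "1 * 1 \<le> real (Suc n) * (L + 1)"
      using L by (intro mult_mono) auto
    then show "c \<le> 1" by (simp add: c_def field_simps)
    fix x and \<delta> :: real
    assume "x \<in> A n" "0 < \<delta>"
    then obtain y where y: "y \<in> D" "0 < dist x y" "dist x y < \<delta>" "dist x y / real (Suc n) < norm (f y)"
      unfolding A_def by blast
    have "w \<notin> A n" if w: "dist y w < c * dist x y" for w
    proof
      assume "w \<in> A n"
      then have "w \<in> D" "f w = 0" by (auto simp: A_def)
      then have "norm (f y) \<le> L * dist y w"
        using lipschitz_onD[OF lip y(1) \<open>w \<in> D\<close>] by (simp add: dist_norm)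
      also have "\<dots> \<le> (L + 1) * (c * dist x y)"
        using w L by (intro mult_mono) auto
      also have "\<dots> = dist x y / real (Suc n)"
      proof -
        have "L + 1 \<noteq> 0" using L by simp
        then show ?thesis by (simp add: c_def del: of_nat_Suc)
      qed
      finally show False using y(4) by simp
    qed
    then have "ball y (c * dist x y) \<inter> A n = {}" by auto
    then show "\<exists>y r. 0 < r \<and> r < \<delta> \<and> x \<in> cball y r \<and> ball y (c * r) \<inter> A n = {}"
      using y by (intro exI[of _ y] exI[of _ "dist x y"]) (auto simp: dist_commute)
  qed
  then have "negligible (\<Union>n. A n)" by (intro negligible_countable_Union) auto
  moreover have "(f has_derivative (\<lambda>_. 0)) (at x within D)"
    if x: "x \<in> D" "f x = 0" "x \<notin> (\<Union>n. A n)" for x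
    unfolding has_derivative_within_alt
  proof (intro conjI allI impI)
    fix e :: real assume "e > 0"
    then obtain n where n: "inverse (real (Suc n)) < e" using reals_Archimedean by blast
    have "x \<notin> A n" using x(3) by blast
    then obtain d where d: "d > 0"
      "\<And>y. y \<in> D \<Longrightarrow> 0 < dist x y \<Longrightarrow> dist x y < d \<Longrightarrow> norm (f y) \<le> dist x y / real (Suc n)"
      using x(1,2) unfolding A_def mem_Collect_eq by (meson not_less)
    have "norm (f y - f x - 0) \<le> e * norm (y - x)" if "y \<in> D" "norm (y - x) < d" for y
    proof (cases "y = x")
      case False
      then have "norm (f y) \<le> inverse (real (Suc n)) * norm (y - x)"
        using d(2)[of y] that by (simp add: dist_norm norm_minus_commute field_simps)
      also have "\<dots> \<le> e * norm (y - x)" using n by (intro mult_right_mono) auto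
      finally show ?thesis using x by simp
    qed simp
    then show "\<exists>d>0. \<forall>y\<in>D. norm (y - x) < d \<longrightarrow> norm (f y - f x - 0) \<le> e * norm (y - x)"
      using d(1) by blast
  qed simp
  ultimately show ?thesis by (elim negligible_subset) auto
qed

section \<open>Polygonal curves and their limits\<close>

definition ramp :: "real \<Rightarrow> real" where
  "ramp x = max 0 (min 1 x)"

text \<open>
  The polygon with vertices \<open>x\<^sub>0 + h *\<^sub>R (V 0 + \<dots> + V (k - 1))\<close> at the times \<open>k * h\<close>. Writing it as
  a sum of ramps expresses each increment as a combination of the velocities with nonnegative
  weights whose sum is the elapsed time.
\<close>

definition polygon :: "'a::real_vector \<Rightarrow> (nat \<Rightarrow> 'a) \<Rightarrow> real \<Rightarrow> nat \<Rightarrow> real \<Rightarrow> 'a" where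
  "polygon x\<^sub>0 V h N t = x\<^sub>0 + (\<Sum>k<N. (h * ramp (t / h - real k)) *\<^sub>R V k)"

lemma ramp_mono: "x \<le> y \<Longrightarrow> ramp x \<le> ramp y"
  by (simp add: ramp_def)

lemma sum_ramp: "(\<Sum>k<N. ramp (y - real k)) = max 0 (min (real N) y)"
proof (induction N)
  case (Suc N)
  then show ?case by (simp add: ramp_def max_def min_def)
qed simp

lemma polygon_at_grid:
  assumes "h > 0" "j \<le> N"
  shows "polygon x\<^sub>0 V h N (real j * h) = x\<^sub>0 + h *\<^sub>R (\<Sum>k<j. V k)"
proof -
  have "(\<Sum>k<N. (h * ramp (real j * h / h - real k)) *\<^sub>R V k) = (\<Sum>k<j. h *\<^sub>R V k)"
    using assms by (intro sum.mono_neutral_cong_right) (auto simp: ramp_def)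
  then show ?thesis by (simp add: polygon_def scaleR_sum_right)
qed

text \<open>
  A difference quotient is a convex combination of the velocities of those steps that overlap
  the time interval.
\<close>

lemma polygon_difference_quotient:
  assumes h: "h > 0" and st: "0 \<le> s" "s < t" "t \<le> real N * h"
    and C: "convex C"
    and V: "\<And>k. k < N \<Longrightarrow> s < real (Suc k) * h \<Longrightarrow> real k * h < t \<Longrightarrow> V k \<in> C"
  shows "(polygon x\<^sub>0 V h N t - polygon x\<^sub>0 V h N s) /\<^sub>R (t - s) \<in> C"
proof -
  define w where "w k = h * (ramp (t / h - real k) - ramp (s / h - real k)) / (t - s)" for k
  have w0: "w k \<ge> 0" for k
    using h st by (auto simp: w_def divide_right_mono intro!: divide_nonneg_pos mult_nonneg_nonneg ramp_mono)
  have "(\<Sum>k<N. w k) = h * ((\<Sum>k<N. ramp (t / h - real k)) - (\<Sum>k<N. ramp (s / h - real k))) / (t - s)"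
    by (simp add: w_def sum_divide_distrib[symmetric] sum_distrib_left[symmetric] sum_subtractf)
  also have "\<dots> = h * (t / h - s / h) / (t - s)"
  proof -
    have "0 \<le> s / h" "s / h \<le> t / h" "t / h \<le> real N"
      using h st by (auto simp: divide_right_mono pos_divide_le_eq)
    then show ?thesis by (simp add: sum_ramp)
  qed
  also have "\<dots> = 1" using h st by (simp add: field_simps)
  finally have w1: "(\<Sum>k<N. w k) = 1" .
  define J where "J = {k. k < N \<and> w k \<noteq> 0}"
  have VJ: "V k \<in> C" if "k \<in> J" for k
  proof (rule V)
    show "k < N" using that by (simp add: J_def)
    show "s < real (Suc k) * h"
    proof (rule ccontr)
      assume "\<not> ?thesis"
      then have "real (Suc k) \<le> s / h" "real (Suc k) \<le> t / h"
        using h st by (auto simp: pos_le_divide_eq)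
      then have "w k = 0" by (simp add: w_def ramp_def)
      then show False using that by (simp add: J_def)
    qed
    show "real k * h < t"
    proof (rule ccontr)
      assume "\<not> ?thesis"
      then have "s / h \<le> real k" "t / h \<le> real k"
        using h st by (auto simp: pos_divide_le_eq)
      then have "w k = 0" by (simp add: w_def ramp_def)
      then show False using that by (simp add: J_def)
    qed
  qed
  have "(\<Sum>k\<in>J. w k) = 1"
    unfolding w1[symmetric] J_def by (rule sum.mono_neutral_left) auto
  then have "(\<Sum>k\<in>J. w k *\<^sub>R V k) \<in> C"
    using VJ w0 by (intro convex_sum C) (auto simp: J_def)
  also have "(\<Sum>k\<in>J. w k *\<^sub>R V k) = (\<Sum>k<N. w k *\<^sub>R V k)"
    unfolding J_def by (rule sum.mono_neutral_left) auto
  also have "\<dots> = (polygon x\<^sub>0 V h N t - polygon x\<^sub>0 V h N s) /\<^sub>R (t - s)"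
    by (simp add: polygon_def w_def sum_subtractf[symmetric] scaleR_sum_right scaleR_diff_left[symmetric]
        right_diff_distrib divide_inverse mult_ac)
  finally show ?thesis .
qed

lemma polygon_lipschitz:
  fixes V :: "nat \<Rightarrow> 'a::real_normed_vector"
  assumes "h > 0" and V: "\<And>k. k < N \<Longrightarrow> norm (V k) \<le> M" and "M \<ge> 0"
  shows "M-lipschitz_on {0..real N * h} (polygon x\<^sub>0 V h N)"
proof (rule lipschitz_onI)
  have *: "dist (polygon x\<^sub>0 V h N s) (polygon x\<^sub>0 V h N t) \<le> M * dist s t"
    if "0 \<le> s" "s < t" "t \<le> real N * h" for s t
  proof -
    have "(polygon x\<^sub>0 V h N t - polygon x\<^sub>0 V h N s) /\<^sub>R (t - s) \<in> cball 0 M"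
      using assms that by (intro polygon_difference_quotient) auto
    then have "norm (polygon x\<^sub>0 V h N t - polygon x\<^sub>0 V h N s) / (t - s) \<le> M"
      using that by (simp add: divide_inverse mult.commute)
    then show ?thesis
      using that by (simp add: pos_divide_le_eq dist_norm norm_minus_commute)
  qed
  fix s t assume "s \<in> {0..real N * h}" "t \<in> {0..real N * h}"
  then show "dist (polygon x\<^sub>0 V h N s) (polygon x\<^sub>0 V h N t) \<le> M * dist s t"
    using *[of s t] *[of t s] by (cases s t rule: linorder_cases) (auto simp: dist_commute)
qed fact

text \<open>
  Compactness with enough control on velocities: by the Arzela-Ascoli theorem some subsequence of
  polygons with bounded velocities converges, and any closed convex set that contains the velocities
  near a time \<open>\<tau>\<close> contains the difference quotients of the limit near \<open>\<tau>\<close>. All properties of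
  the limiting curve are instances of this one principle for suitable convex sets.
\<close>

lemma polygon_limit:
  fixes x\<^sub>0 :: "'a::euclidean_space" and V :: "nat \<Rightarrow> nat \<Rightarrow> 'a"
  defines "P \<equiv> \<lambda>T n. polygon x\<^sub>0 (V n) (T / real (Suc n)) (Suc n)"
  assumes T: "T > 0" and M: "M \<ge> 0" "\<And>n k. norm (V n k) \<le> M"
  obtains x \<sigma> where
    "strict_mono (\<sigma> :: nat \<Rightarrow> nat)"
    "uniform_limit {0..T} (\<lambda>n. P T (\<sigma> n)) x sequentially"
    "x 0 = x\<^sub>0"
    "M-lipschitz_on {0..T} x"
    "\<And>C \<tau> \<delta> s t. closed C \<Longrightarrow> convex C \<Longrightarrow> \<delta> > 0 \<Longrightarrow>
       (\<forall>\<^sub>F n in sequentially. \<forall>k\<le>\<sigma> n.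
          \<bar>real k * (T / real (Suc (\<sigma> n))) - \<tau>\<bar> < \<delta> \<longrightarrow> V (\<sigma> n) k \<in> C) \<Longrightarrow>
       0 \<le> s \<Longrightarrow> s < t \<Longrightarrow> t \<le> T \<Longrightarrow> \<tau> - \<delta> < s \<Longrightarrow> t < \<tau> + \<delta> \<Longrightarrow>
       (x t - x s) /\<^sub>R (t - s) \<in> C"
proof -
  define h where "h n = T / real (Suc n)" for n
  have h: "h n > 0" "real (Suc n) * h n = T" for n
    using T by (auto simp: h_def)
  have P_def': "P T n = polygon x\<^sub>0 (V n) (h n) (Suc n)" for n
    by (simp add: P_def h_def)
  have lip: "M-lipschitz_on {0..T} (P T n)" for n
    using polygon_lipschitz[OF h(1)[of n], of "Suc n" "V n" M x\<^sub>0] M by (simp only: P_def' h(2))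
  have P0: "P T n 0 = x\<^sub>0" for n
    using polygon_at_grid[OF h(1)[of n], of 0] by (simp add: P_def')
  have bdd: "norm (P T n t) \<le> norm x\<^sub>0 + M * T" if "t \<in> {0..T}" for n t
  proof -
    have "dist (P T n t) (P T n 0) \<le> M * dist t 0"
      using that T by (intro lipschitz_onD[OF lip]) auto
    also have "\<dots> \<le> M * T" using that M by (intro mult_left_mono) auto
    finally have "norm (P T n t - x\<^sub>0) \<le> M * T" by (simp add: P0 dist_norm)
    then show ?thesis using norm_triangle_ineq2[of "P T n t" x\<^sub>0] by linarith
  qed
  have equi: "\<exists>d>0. \<forall>n y. y \<in> {0..T} \<and> norm (t - y) < d \<longrightarrow> norm (P T n t - P T n y) < e"
    if "t \<in> {0..T}" "0 < e" for t e
  proof (intro exI conjI allI impI)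
    show "e / (M + 1) > 0" using M that by simp
    fix n y assume y: "y \<in> {0..T} \<and> norm (t - y) < e / (M + 1)"
    have "norm (P T n t - P T n y) \<le> M * norm (t - y)"
      using lipschitz_onD[OF lip \<open>t \<in> {0..T}\<close>] y by (simp add: dist_norm)
    also have "\<dots> \<le> (M + 1) * norm (t - y)" using M by (intro mult_right_mono) auto
    also have "\<dots> < e" using y M by (simp add: pos_less_divide_eq mult.commute)
    finally show "norm (P T n t - P T n y) < e" .
  qed
  obtain x \<sigma> where \<sigma>: "strict_mono (\<sigma> :: nat \<Rightarrow> nat)" and
    conv: "\<And>e. 0 < e \<Longrightarrow> \<exists>N. \<forall>n t. n \<ge> N \<and> t \<in> {0..T} \<longrightarrow> norm (P T (\<sigma> n) t - x t) < e"
    by (rule Arzela_Ascoli[of "{0..T}" "P T" "norm x\<^sub>0 + M * T", OF compact_Icc bdd equi]) blast+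
  have unif: "uniform_limit {0..T} (\<lambda>n. P T (\<sigma> n)) x sequentially"
    unfolding uniform_limit_sequentially_iff dist_norm using conv by blast
  then have lim: "(\<lambda>n. P T (\<sigma> n) t) \<longlonglongrightarrow> x t" if "t \<in> {0..T}" for t
    using that by (rule tendsto_uniform_limitI)
  have "x 0 = x\<^sub>0"
    using lim[of 0] T by (simp add: P0 LIMSEQ_const_iff)
  have mesh: "(\<lambda>n. h (\<sigma> n)) \<longlonglongrightarrow> 0"
  proof -
    have "h \<longlonglongrightarrow> 0"
      unfolding h_def using tendsto_mult_right_zero[OF LIMSEQ_inverse_real_of_nat, of T]
      by (simp add: divide_inverse)
    then show ?thesis using LIMSEQ_subseq_LIMSEQ[OF _ \<sigma>] by (simp add: o_def)
  qed
  show thesis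
  proof (rule that[OF \<sigma> unif \<open>x 0 = x\<^sub>0\<close>])
    show "M-lipschitz_on {0..T} x"
    proof (rule lipschitz_onI)
      fix s t assume st: "s \<in> {0..T}" "t \<in> {0..T}"
      have "(\<lambda>n. dist (P T (\<sigma> n) s) (P T (\<sigma> n) t)) \<longlonglongrightarrow> dist (x s) (x t)"
        using st by (intro tendsto_intros lim)
      then show "dist (x s) (x t) \<le> M * dist s t"
        by (rule LIMSEQ_le_const2) (use lipschitz_onD[OF lip] st in blast)
    qed (rule M)
    fix C \<tau> \<delta> s t
    assume C: "closed C" "convex C" "\<delta> > 0" and
      ev: "\<forall>\<^sub>F n in sequentially. \<forall>k\<le>\<sigma> n.
          \<bar>real k * (T / real (Suc (\<sigma> n))) - \<tau>\<bar> < \<delta> \<longrightarrow> V (\<sigma> n) k \<in> C"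
      and st: "0 \<le> s" "s < t" "t \<le> T" "\<tau> - \<delta> < s" "t < \<tau> + \<delta>"
    have "\<forall>\<^sub>F n in sequentially. h (\<sigma> n) < s - (\<tau> - \<delta>)"
      using order_tendstoD(2)[OF mesh] st by simp
    with ev have "\<forall>\<^sub>F n in sequentially. (P T (\<sigma> n) t - P T (\<sigma> n) s) /\<^sub>R (t - s) \<in> C"
    proof eventually_elim
      case (elim n)
      show ?case
        unfolding P_def'
      proof (rule polygon_difference_quotient[OF h(1) st(1,2) _ C(2)])
        show "t \<le> real (Suc (\<sigma> n)) * h (\<sigma> n)" unfolding h(2) by (rule st)
        fix k assume k: "k < Suc (\<sigma> n)" "s < real (Suc k) * h (\<sigma> n)" "real k * h (\<sigma> n) < t"
        have "\<bar>real k * h (\<sigma> n) - \<tau>\<bar> < \<delta>"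
          using k st elim(2) by (simp add: distrib_right)
        then show "V (\<sigma> n) k \<in> C" using elim(1) k(1) by (simp add: h_def)
      qed
    qed
    moreover have "(\<lambda>n. (P T (\<sigma> n) t - P T (\<sigma> n) s) /\<^sub>R (t - s)) \<longlonglongrightarrow> (x t - x s) /\<^sub>R (t - s)"
      using st by (intro tendsto_intros lim) auto
    ultimately show "(x t - x s) /\<^sub>R (t - s) \<in> C"
      using C(1) by (intro Lim_in_closed_set) auto
  qed
qed

section \<open>Reflected curves in a double wedge\<close>

definition double_wedge :: "'a::real_inner \<Rightarrow> 'a \<Rightarrow> 'a set" where
  "double_wedge p q = {\<xi>. (p \<bullet> \<xi>) * (q \<bullet> \<xi>) \<le> 0}"

text \<open>
  The shift of smallest modulus that carries \<open>(\<alpha>, \<beta>)\<close> along the diagonal to coordinates that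
  do not have the same strict sign. When \<open>p \<bullet> b = q \<bullet> b = 1\<close>, adding \<open>push (p \<bullet> y) (q \<bullet> y) *\<^sub>R b\<close> to \<open>y\<close> projects
  \<open>y\<close> along \<open>b\<close> onto the double wedge.
\<close>

definition push :: "real \<Rightarrow> real \<Rightarrow> real" where
  "push \<alpha> \<beta> = (if 0 < \<alpha> \<and> 0 < \<beta> then - min \<alpha> \<beta> else if \<alpha> < 0 \<and> \<beta> < 0 then - max \<alpha> \<beta> else 0)"

lemma push_into_wedge: "(\<alpha> + push \<alpha> \<beta>) * (\<beta> + push \<alpha> \<beta>) \<le> 0"
  by (auto simp: push_def min_def max_def mult_le_0_iff not_less)

text \<open>
  A downward shift stops on the upper face of the wedge, where both coordinates are nonnegative.
\<close>

lemma push_nonneg: "\<alpha> + push \<alpha> \<beta> < 0 \<or> \<beta> + push \<alpha> \<beta> < 0 \<Longrightarrow> push \<alpha> \<beta> \<ge> 0"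
  by (auto simp: push_def min_def max_def split: if_splits)

lemma push_nonpos: "\<alpha> + push \<alpha> \<beta> > 0 \<or> \<beta> + push \<alpha> \<beta> > 0 \<Longrightarrow> push \<alpha> \<beta> \<le> 0"
  by (auto simp: push_def min_def max_def split: if_splits)

lemma abs_push_le:
  assumes "\<alpha>\<^sub>0 * \<beta>\<^sub>0 \<le> 0"
  shows "\<bar>push \<alpha> \<beta>\<bar> \<le> \<bar>\<alpha> - \<alpha>\<^sub>0\<bar> + \<bar>\<beta> - \<beta>\<^sub>0\<bar>"
  using assms by (auto simp: push_def min_def max_def mult_le_0_iff)

text \<open>
  One step follows the vector field for time \<open>h\<close> and then projects back along \<open>b\<close>. The push
  \<open>h * l k\<close> is of order \<open>h\<close> because the step started in the wedge. Its sign is determined by the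
  face that the projected point lies on, and this is the form of the projection law that survives the
  passage to the limit.
\<close>

lemma catch_up_scheme:
  fixes p q b :: "'a::real_inner" and F :: "'a \<Rightarrow> 'a"
  assumes pb: "p \<bullet> b = 1" and qb: "q \<bullet> b = 1"
    and F: "\<And>\<xi>. norm (F \<xi>) \<le> M" and \<xi>\<^sub>0: "\<xi>\<^sub>0 \<in> double_wedge p q" and h: "h > 0"
  obtains y l where
    "\<And>k. y k = \<xi>\<^sub>0 + h *\<^sub>R (\<Sum>j<k. F (y j) + l j *\<^sub>R b)"
    "\<And>k. y k \<in> double_wedge p q"
    "\<And>k. \<bar>l k\<bar> \<le> (norm p + norm q) * M"
    "\<And>r k. r \<in> {p, q} \<Longrightarrow> r \<bullet> y (Suc k) < 0 \<Longrightarrow> l k \<ge> 0"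
    "\<And>r k. r \<in> {p, q} \<Longrightarrow> r \<bullet> y (Suc k) > 0 \<Longrightarrow> l k \<le> 0"
proof -
  define \<mu> where "\<mu> \<xi> = push (p \<bullet> (\<xi> + h *\<^sub>R F \<xi>)) (q \<bullet> (\<xi> + h *\<^sub>R F \<xi>)) / h" for \<xi>
  define y where "y k = ((\<lambda>\<xi>. \<xi> + h *\<^sub>R (F \<xi> + \<mu> \<xi> *\<^sub>R b)) ^^ k) \<xi>\<^sub>0" for k
  define l where "l k = \<mu> (y k)" for k
  have ySuc: "y (Suc k) = y k + h *\<^sub>R (F (y k) + l k *\<^sub>R b)" for k
    by (simp add: y_def l_def)
  have hl: "h * l k = push (p \<bullet> (y k + h *\<^sub>R F (y k))) (q \<bullet> (y k + h *\<^sub>R F (y k)))" for k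
    using h by (simp add: l_def \<mu>_def)
  have r: "r \<bullet> y (Suc k) = r \<bullet> (y k + h *\<^sub>R F (y k)) + h * l k" if "r \<in> {p, q}" for r k
    using that pb qb by (auto simp: ySuc inner_add_right algebra_simps)
  have wedge: "y k \<in> double_wedge p q" for k
  proof (cases k)
    case 0
    then show ?thesis using \<xi>\<^sub>0 by (simp add: y_def)
  next
    case (Suc j)
    then show ?thesis
      using push_into_wedge by (simp add: double_wedge_def r hl)
  qed
  show thesis
  proof (rule that)
    show "y k = \<xi>\<^sub>0 + h *\<^sub>R (\<Sum>j<k. F (y j) + l j *\<^sub>R b)" for k
    proof (induction k)
      case (Suc k)
      then show ?case by (simp add: ySuc scaleR_add_right)
    qed (simp add: y_def)
    show "y k \<in> double_wedge p q" for k by (rule wedge)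
    show "\<bar>l k\<bar> \<le> (norm p + norm q) * M" for k
    proof -
      have "h * \<bar>l k\<bar> = \<bar>h * l k\<bar>" using h by (simp add: abs_mult)
      also have "\<dots> \<le> \<bar>p \<bullet> (y k + h *\<^sub>R F (y k)) - p \<bullet> y k\<bar> + \<bar>q \<bullet> (y k + h *\<^sub>R F (y k)) - q \<bullet> y k\<bar>"
        unfolding hl using wedge[of k] by (intro abs_push_le) (simp add: double_wedge_def)
      also have "\<dots> = h * (\<bar>p \<bullet> F (y k)\<bar> + \<bar>q \<bullet> F (y k)\<bar>)"
        using h by (simp add: inner_add_right abs_mult distrib_left)
      also have "\<dots> \<le> h * (norm p * M + norm q * M)"
        using h F by (intro mult_left_mono add_mono order_trans[OF Cauchy_Schwarz_ineq2] mult_left_mono) auto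
      finally show ?thesis using h by (simp add: distrib_right)
    qed
    fix r k assume rpq: "r \<in> {p, q}"
    have "h * l k \<ge> 0" if "r \<bullet> y (Suc k) < 0"
      using that rpq unfolding hl r[OF rpq] by (intro push_nonneg) auto
    then show "r \<bullet> y (Suc k) < 0 \<Longrightarrow> l k \<ge> 0" using h by (simp add: zero_le_mult_iff)
    have "h * l k \<le> 0" if "r \<bullet> y (Suc k) > 0"
      using that rpq unfolding hl r[OF rpq] by (intro push_nonpos) auto
    then show "r \<bullet> y (Suc k) > 0 \<Longrightarrow> l k \<le> 0" using h by (simp add: mult_le_0_iff)
  qed
qed

text \<open>
  Passes from the two-sided difference quotients that \<open>polygon_limit\<close> controls to a derivative.
\<close>

lemma has_vector_derivative_withinI_difference_quotient:
  fixes g :: "real \<Rightarrow> 'a::real_normed_vector"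
  assumes "\<And>\<epsilon>. \<epsilon> > 0 \<Longrightarrow> \<exists>\<delta>>0. \<forall>s\<in>D. \<forall>t\<in>D. \<tau> - \<delta> < s \<longrightarrow> s < t \<longrightarrow> t < \<tau> + \<delta> \<longrightarrow>
      (g t - g s) /\<^sub>R (t - s) \<in> cball v \<epsilon>"
    and "\<tau> \<in> D"
  shows "(g has_vector_derivative v) (at \<tau> within D)"
  unfolding has_vector_derivative_def has_derivative_within_alt
proof (intro conjI allI impI)
  show "bounded_linear (\<lambda>h. h *\<^sub>R v)" by (rule bounded_linear_scaleR_left)
  fix \<epsilon> :: real assume "\<epsilon> > 0"
  then obtain \<delta> where \<delta>: "\<delta> > 0" and
    quot: "\<And>s t. s \<in> D \<Longrightarrow> t \<in> D \<Longrightarrow> \<tau> - \<delta> < s \<Longrightarrow> s < t \<Longrightarrow> t < \<tau> + \<delta> \<Longrightarrow>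
      (g t - g s) /\<^sub>R (t - s) \<in> cball v \<epsilon>"
    using assms(1) by meson
  have est: "norm (g t - g s - (t - s) *\<^sub>R v) \<le> \<epsilon> * (t - s)"
    if "s \<in> D" "t \<in> D" "\<tau> - \<delta> < s" "s < t" "t < \<tau> + \<delta>" for s t
  proof -
    have "g t - g s - (t - s) *\<^sub>R v = (t - s) *\<^sub>R ((g t - g s) /\<^sub>R (t - s) - v)"
      using that by (simp add: scaleR_diff_right)
    then have "norm (g t - g s - (t - s) *\<^sub>R v) = (t - s) * norm ((g t - g s) /\<^sub>R (t - s) - v)"
      using that by simp
    also have "\<dots> \<le> (t - s) * \<epsilon>"
      using quot[OF that] that by (intro mult_left_mono) (auto simp: dist_norm norm_minus_commute)
    finally show ?thesis by (simp add: mult.commute)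
  qed
  have "norm (g y - g \<tau> - (y - \<tau>) *\<^sub>R v) \<le> \<epsilon> * norm (y - \<tau>)"
    if y: "y \<in> D" "norm (y - \<tau>) < \<delta>" for y
  proof (cases y \<tau> rule: linorder_cases)
    case less
    have "g y - g \<tau> - (y - \<tau>) *\<^sub>R v = - (g \<tau> - g y - (\<tau> - y) *\<^sub>R v)"
      by (simp add: algebra_simps)
    then show ?thesis
      using est[of y \<tau>] less y \<open>\<tau> \<in> D\<close> \<delta> by (simp only: norm_minus_cancel) auto
  qed (use est[of \<tau> y] y \<open>\<tau> \<in> D\<close> \<delta> in auto)
  then show "\<exists>d>0. \<forall>y\<in>D. norm (y - \<tau>) < d \<longrightarrow>
      norm (g y - g \<tau> - (y - \<tau>) *\<^sub>R v) \<le> \<epsilon> * norm (y - \<tau>)"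
    using \<delta> by blast
qed

text \<open>
  The limit of the catch-up scheme splits into \<open>g\<close>, which follows the vector field, and the
  accumulated push \<open>\<Lambda>\<close> along \<open>b\<close>. Keeping the two apart in a product space makes \<open>g\<close>
  differentiable everywhere, and leaves for \<open>\<Lambda>\<close> only monotonicity where the curve is off a
  boundary line. At the vertex of the wedge nothing is claimed about \<open>\<Lambda>\<close>. The sets used in \<open>polygon_limit\<close> are small balls around
  the vector field for \<open>g\<close> and half lines for \<open>\<Lambda>\<close>.
\<close>

lemma reflected_curve_exists:
  fixes p q b \<xi>\<^sub>0 :: "'a::euclidean_space" and F :: "'a \<Rightarrow> 'a"
  assumes pb: "p \<bullet> b = 1" and qb: "q \<bullet> b = 1"
    and F: "\<And>\<xi>. norm (F \<xi>) \<le> M" "continuous_on UNIV F"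
    and \<xi>\<^sub>0: "\<xi>\<^sub>0 \<in> double_wedge p q" and T: "T > 0"
  obtains g :: "real \<Rightarrow> 'a" and \<Lambda> :: "real \<Rightarrow> real" and L
  where "g 0 = \<xi>\<^sub>0" "\<Lambda> 0 = 0"
    "L-lipschitz_on {0..T} g" "L-lipschitz_on {0..T} \<Lambda>"
    "\<And>t. t \<in> {0..T} \<Longrightarrow> g t + \<Lambda> t *\<^sub>R b \<in> double_wedge p q"
    "\<And>t. t \<in> {0..T} \<Longrightarrow> (g has_vector_derivative F (g t + \<Lambda> t *\<^sub>R b)) (at t within {0..T})"
    "\<And>r \<tau>. r \<in> {p, q} \<Longrightarrow> \<tau> \<in> {0..T} \<Longrightarrow> r \<bullet> (g \<tau> + \<Lambda> \<tau> *\<^sub>R b) < 0 \<Longrightarrow>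
       \<exists>\<delta>>0. mono_on ({0..T} \<inter> {\<tau> - \<delta><..<\<tau> + \<delta>}) \<Lambda>"
    "\<And>r \<tau>. r \<in> {p, q} \<Longrightarrow> \<tau> \<in> {0..T} \<Longrightarrow> r \<bullet> (g \<tau> + \<Lambda> \<tau> *\<^sub>R b) > 0 \<Longrightarrow>
       \<exists>\<delta>>0. mono_on ({0..T} \<inter> {\<tau> - \<delta><..<\<tau> + \<delta>}) (\<lambda>t. - \<Lambda> t)"
proof -
  define h where "h n = T / real (Suc n)" for n
  have h: "h n > 0" "real (Suc n) * h n = T" for n
    using T by (auto simp: h_def)
  define scheme where "scheme n y l \<longleftrightarrow> (\<forall>k. y k = \<xi>\<^sub>0 + h n *\<^sub>R (\<Sum>j<k. F (y j) + l j *\<^sub>R b)) \<and>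
      (\<forall>k. y k \<in> double_wedge p q) \<and>
      (\<forall>k. \<bar>l k\<bar> \<le> (norm p + norm q) * M) \<and>
      (\<forall>r\<in>{p, q}. \<forall>k. (r \<bullet> y (Suc k) < 0 \<longrightarrow> l k \<ge> 0) \<and> (r \<bullet> y (Suc k) > 0 \<longrightarrow> l k \<le> 0))"
    for n y l
  have "\<exists>y l. scheme n y l" for n
    by (rule catch_up_scheme[where F=F, OF pb qb F(1) \<xi>\<^sub>0 h(1)[of n]]) (unfold scheme_def, blast)
  then obtain y l where yl: "\<And>n. scheme n (y n) (l n)"
    by metis
  have y: "y n k = \<xi>\<^sub>0 + h n *\<^sub>R (\<Sum>j<k. F (y n j) + l n j *\<^sub>R b)"
    and wedge: "y n k \<in> double_wedge p q"
    and l: "\<bar>l n k\<bar> \<le> (norm p + norm q) * M" for n k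
    using yl[of n] unfolding scheme_def by blast+
  have sign: "r \<bullet> y n (Suc k) < 0 \<Longrightarrow> l n k \<ge> 0" "r \<bullet> y n (Suc k) > 0 \<Longrightarrow> l n k \<le> 0"
    if "r \<in> {p, q}" for n r k
    using yl[of n] that unfolding scheme_def by blast+
  have "M \<ge> 0" using F(1)[of 0] norm_ge_zero order_trans by blast
  define V where "V n k = (F (y n k), l n k)" for n k
  define L where "L = M + (norm p + norm q) * M"
  have V: "norm (V n k) \<le> L" for n k
    using norm_Pair_le[of "F (y n k)" "l n k"] F(1)[of "y n k"] l[of n k]
    by (simp add: V_def L_def)
  define P where "P n = polygon (\<xi>\<^sub>0, 0) (V n) (T / real (Suc n)) (Suc n)" for n
  have "L \<ge> 0" using \<open>M \<ge> 0\<close> by (simp add: L_def)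
  obtain x \<sigma> where \<sigma>: "strict_mono (\<sigma> :: nat \<Rightarrow> nat)"
    and unif: "uniform_limit {0..T} (\<lambda>n. P (\<sigma> n)) x sequentially"
    and x0: "x 0 = (\<xi>\<^sub>0, 0)"
    and lip: "L-lipschitz_on {0..T} x"
    and incl: "\<And>C \<tau> \<delta> s t. closed C \<Longrightarrow> convex C \<Longrightarrow> \<delta> > 0 \<Longrightarrow>
       (\<forall>\<^sub>F n in sequentially. \<forall>k\<le>\<sigma> n.
          \<bar>real k * (T / real (Suc (\<sigma> n))) - \<tau>\<bar> < \<delta> \<longrightarrow> V (\<sigma> n) k \<in> C) \<Longrightarrow>
       0 \<le> s \<Longrightarrow> s < t \<Longrightarrow> t \<le> T \<Longrightarrow> \<tau> - \<delta> < s \<Longrightarrow> t < \<tau> + \<delta> \<Longrightarrow>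
       (x t - x s) /\<^sub>R (t - s) \<in> C"
    unfolding P_def by (rule polygon_limit[of T L V "(\<xi>\<^sub>0, 0)", OF T \<open>L \<ge> 0\<close> V]) blast
  define join where "join = (\<lambda>w :: 'a \<times> real. fst w + snd w *\<^sub>R b)"
  have join_cont: "continuous_on UNIV join"
    unfolding join_def by (intro continuous_intros)
  have grid: "join (P n (real k * h n)) = y n k" if "k \<le> Suc n" for n k
  proof -
    have "P n (real k * h n) = (\<xi>\<^sub>0, 0) + h n *\<^sub>R (\<Sum>j<k. V n j)"
      unfolding P_def h_def[symmetric] by (rule polygon_at_grid[OF h(1) that])
    then show ?thesis
      unfolding y[of n k]
      by (simp add: join_def V_def fst_sum snd_sum scaleR_add_right sum.distrib scaleR_sum_left
          scaleR_sum_right sum_distrib_left)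
  qed
  define \<xi> where "\<xi> t = join (x t)" for t
  have x_cont: "continuous_on {0..T} x" using lip by (rule lipschitz_on_continuous_on)
  have mesh: "(\<lambda>n. h (\<sigma> n)) \<longlonglongrightarrow> 0"
  proof -
    have "h \<longlonglongrightarrow> 0"
      unfolding h_def using tendsto_mult_right_zero[OF LIMSEQ_inverse_real_of_nat, of T]
      by (simp add: divide_inverse)
    then show ?thesis using LIMSEQ_subseq_LIMSEQ[OF _ \<sigma>] by (simp add: o_def)
  qed
  \<comment> \<open>For fine meshes, the vertices at times near \<open>\<tau>\<close> lie in a given neighbourhood of \<open>\<xi> \<tau>\<close>. The
     end of each step is included, since it is the end that decides the sign of the push.\<close>
  have nodes: "\<exists>\<delta>>0. \<forall>\<^sub>F n in sequentially. \<forall>k\<le>\<sigma> n. \<bar>real k * h (\<sigma> n) - \<tau>\<bar> < \<delta> \<longrightarrow>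
      y (\<sigma> n) k \<in> U \<and> y (\<sigma> n) (Suc k) \<in> U"
    if "\<tau> \<in> {0..T}" "open U" "\<xi> \<tau> \<in> U" for \<tau> U
  proof -
    have "open (join -` U)"
      using join_cont \<open>open U\<close> by (simp add: continuous_on_open_vimage)
    moreover have "x \<tau> \<in> join -` U" using that by (simp add: \<xi>_def)
    ultimately obtain e where e: "e > 0" "\<And>w. dist w (x \<tau>) < e \<Longrightarrow> join w \<in> U"
      unfolding open_dist by blast
    obtain d where d: "d > 0" "\<And>t. t \<in> {0..T} \<Longrightarrow> dist t \<tau> < d \<Longrightarrow> dist (x t) (x \<tau>) < e / 2"
      using x_cont \<open>\<tau> \<in> {0..T}\<close> e(1) unfolding continuous_on_iff by (meson half_gt_zero)
    have "\<forall>\<^sub>F n in sequentially. \<forall>t\<in>{0..T}. dist (P (\<sigma> n) t) (x t) < e / 2"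
      using uniform_limitD[OF unif, of "e / 2"] e(1) by simp
    moreover have "\<forall>\<^sub>F n in sequentially. h (\<sigma> n) < d / 2"
      using order_tendstoD(2)[OF mesh, of "d / 2"] d(1) by simp
    ultimately have "\<forall>\<^sub>F n in sequentially. \<forall>k\<le>\<sigma> n. \<bar>real k * h (\<sigma> n) - \<tau>\<bar> < d / 2 \<longrightarrow>
      y (\<sigma> n) k \<in> U \<and> y (\<sigma> n) (Suc k) \<in> U"
    proof eventually_elim
      case (elim n)
      have node: "y (\<sigma> n) j \<in> U" if "j \<le> Suc (\<sigma> n)" "\<bar>real j * h (\<sigma> n) - \<tau>\<bar> < d" for j
      proof -
        have "real j * h (\<sigma> n) \<le> real (Suc (\<sigma> n)) * h (\<sigma> n)"
          using that(1) h(1) by (intro mult_right_mono) (auto simp del: of_nat_Suc intro: less_imp_le)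
        then have "real j * h (\<sigma> n) \<in> {0..T}"
          using h(1)[of "\<sigma> n"] unfolding h(2) by simp
        then have "dist (P (\<sigma> n) (real j * h (\<sigma> n))) (x \<tau>) < e"
          using elim(1) d(2)[of "real j * h (\<sigma> n)"] that(2)
            dist_triangle_half_r[of "x (real j * h (\<sigma> n))" "P (\<sigma> n) (real j * h (\<sigma> n))" e "x \<tau>"]
          by (simp add: dist_real_def dist_commute)
        then show ?thesis using e(2) grid[OF that(1)] by metis
      qed
      show ?case
      proof (intro allI impI)
        fix k assume k: "k \<le> \<sigma> n" "\<bar>real k * h (\<sigma> n) - \<tau>\<bar> < d / 2"
        have "\<bar>real (Suc k) * h (\<sigma> n) - \<tau>\<bar> < d"
          using k(2) elim(2) h(1)[of "\<sigma> n"] by (simp add: distrib_right abs_if split: if_splits)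
        then show "y (\<sigma> n) k \<in> U \<and> y (\<sigma> n) (Suc k) \<in> U"
          using node[of k] node[of "Suc k"] k d(1) by auto
      qed
    qed
    then show ?thesis using d(1) half_gt_zero by blast
  qed
  have quot: "\<exists>\<delta>>0. \<forall>s\<in>{0..T}. \<forall>t\<in>{0..T}. \<tau> - \<delta> < s \<longrightarrow> s < t \<longrightarrow> t < \<tau> + \<delta> \<longrightarrow>
      (x t - x s) /\<^sub>R (t - s) \<in> C"
    if U: "\<tau> \<in> {0..T}" "open U" "\<xi> \<tau> \<in> U" and C: "closed C" "convex C"
      and rate: "\<And>n k. y n k \<in> U \<Longrightarrow> y n (Suc k) \<in> U \<Longrightarrow> V n k \<in> C" for \<tau> U C
  proof -
    obtain \<delta> where \<delta>: "\<delta> > 0" "\<forall>\<^sub>F n in sequentially. \<forall>k\<le>\<sigma> n. \<bar>real k * h (\<sigma> n) - \<tau>\<bar> < \<delta> \<longrightarrow>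
      y (\<sigma> n) k \<in> U \<and> y (\<sigma> n) (Suc k) \<in> U"
      using nodes[OF U] by blast
    from \<delta>(2) have "\<forall>\<^sub>F n in sequentially. \<forall>k\<le>\<sigma> n.
          \<bar>real k * (T / real (Suc (\<sigma> n))) - \<tau>\<bar> < \<delta> \<longrightarrow> V (\<sigma> n) k \<in> C"
      by eventually_elim (use rate in \<open>simp add: h_def\<close>)
    then show ?thesis
      using incl[OF C \<delta>(1)] \<delta>(1) by (intro exI[of _ \<delta>]) auto
  qed
  define g where "g t = fst (x t)" for t
  define \<Lambda> where "\<Lambda> t = snd (x t)" for t
  have \<xi>_eq: "\<xi> t = g t + \<Lambda> t *\<^sub>R b" for t
    by (simp add: \<xi>_def join_def g_def \<Lambda>_def)
  have wedge_closed: "closed (double_wedge p q)"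
    unfolding double_wedge_def by (intro closed_Collect_le continuous_intros)
  have \<xi>_wedge: "\<xi> \<tau> \<in> double_wedge p q" if \<tau>: "\<tau> \<in> {0..T}" for \<tau>
  proof (rule ccontr)
    \<comment> \<open>Outside the wedge there are no vertices, so the velocities near \<open>\<tau>\<close>, and with
       them the difference quotients of the limit, would lie in the empty set.\<close>
    assume "\<not> ?thesis"
    then have "\<xi> \<tau> \<in> - double_wedge p q" by simp
    moreover have "open (- double_wedge p q)" using wedge_closed by (rule open_Compl)
    ultimately obtain \<delta> where \<delta>: "\<delta> > 0" "\<forall>s\<in>{0..T}. \<forall>t\<in>{0..T}. \<tau> - \<delta> < s \<longrightarrow> s < t \<longrightarrow> t < \<tau> + \<delta> \<longrightarrow>
        (x t - x s) /\<^sub>R (t - s) \<in> {}"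
      using quot[OF \<tau>, of "- double_wedge p q" "{}"] wedge by auto
    define s t where "s = max 0 (\<tau> - \<delta> / 2)" and "t = min T (\<tau> + \<delta> / 2)"
    have "s \<in> {0..T}" "t \<in> {0..T}" "\<tau> - \<delta> < s" "s < t" "t < \<tau> + \<delta>"
      using \<tau> T \<delta>(1) by (auto simp: s_def t_def)
    then show False using \<delta>(2) by blast
  qed
  show thesis
  proof (rule that[of g \<Lambda> L])
    show "g 0 = \<xi>\<^sub>0" "\<Lambda> 0 = 0" by (simp_all add: g_def \<Lambda>_def x0)
    show "L-lipschitz_on {0..T} g"
      using \<open>L \<ge> 0\<close> lipschitz_onD[OF lip] dist_fst_le order_trans unfolding g_def
      by (intro lipschitz_onI) blast+
    show "L-lipschitz_on {0..T} \<Lambda>"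
      using \<open>L \<ge> 0\<close> lipschitz_onD[OF lip] dist_snd_le order_trans unfolding \<Lambda>_def
      by (intro lipschitz_onI) blast+
    show "g t + \<Lambda> t *\<^sub>R b \<in> double_wedge p q" if "t \<in> {0..T}" for t
      using \<xi>_wedge[OF that] by (simp only: \<xi>_eq)
    show "(g has_vector_derivative F (g \<tau> + \<Lambda> \<tau> *\<^sub>R b)) (at \<tau> within {0..T})" if \<tau>: "\<tau> \<in> {0..T}" for \<tau>
    proof (rule has_vector_derivative_withinI_difference_quotient[OF _ \<tau>])
      fix \<epsilon> :: real assume "\<epsilon> > 0"
      let ?U = "F -` ball (F (\<xi> \<tau>)) \<epsilon>" and ?C = "cball (F (\<xi> \<tau>)) \<epsilon> \<times> (UNIV :: real set)"
      have "open ?U" using F(2) by (simp add: continuous_on_open_vimage)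
      moreover have "\<xi> \<tau> \<in> ?U" using \<open>\<epsilon> > 0\<close> by simp
      moreover have "closed ?C" "convex ?C" by (auto intro: closed_Times convex_Times)
      ultimately obtain \<delta> where "\<delta> > 0" "\<forall>s\<in>{0..T}. \<forall>t\<in>{0..T}. \<tau> - \<delta> < s \<longrightarrow> s < t \<longrightarrow> t < \<tau> + \<delta> \<longrightarrow>
        (x t - x s) /\<^sub>R (t - s) \<in> ?C"
        using quot[OF \<tau>, of ?U ?C] by (auto simp: V_def)
      then show "\<exists>\<delta>>0. \<forall>s\<in>{0..T}. \<forall>t\<in>{0..T}. \<tau> - \<delta> < s \<longrightarrow> s < t \<longrightarrow> t < \<tau> + \<delta> \<longrightarrow>
        (g t - g s) /\<^sub>R (t - s) \<in> cball (F (g \<tau> + \<Lambda> \<tau> *\<^sub>R b)) \<epsilon>"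
        unfolding \<xi>_eq g_def \<Lambda>_def by (intro exI[of _ \<delta>]) (simp add: mem_Times_iff)
    qed
    fix r \<tau> assume r: "r \<in> {p, q}" and \<tau>: "\<tau> \<in> {0..T}"
    show "\<exists>\<delta>>0. mono_on ({0..T} \<inter> {\<tau> - \<delta><..<\<tau> + \<delta>}) \<Lambda>" if "r \<bullet> (g \<tau> + \<Lambda> \<tau> *\<^sub>R b) < 0"
    proof -
      have op: "open {\<xi>. r \<bullet> \<xi> < 0}" by (intro open_Collect_less continuous_intros)
      have "\<xi> \<tau> \<in> {\<xi>. r \<bullet> \<xi> < 0}" using that by (simp add: \<xi>_eq)
      moreover have "closed ((UNIV :: 'a set) \<times> {0::real..})" "convex ((UNIV :: 'a set) \<times> {0::real..})"
        by (auto intro: closed_Times convex_Times)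
      moreover have "V n k \<in> UNIV \<times> {0..}" if "y n (Suc k) \<in> {\<xi>. r \<bullet> \<xi> < 0}" for n k
        using that sign(1)[OF r] by (simp add: V_def)
      ultimately obtain \<delta> where \<delta>: "\<delta> > 0" "\<forall>s\<in>{0..T}. \<forall>t\<in>{0..T}. \<tau> - \<delta> < s \<longrightarrow> s < t \<longrightarrow> t < \<tau> + \<delta> \<longrightarrow>
        (x t - x s) /\<^sub>R (t - s) \<in> UNIV \<times> {0..}"
        using quot[OF \<tau> op] by blast
      have "\<Lambda> s \<le> \<Lambda> t" if "s \<in> {0..T}" "t \<in> {0..T}" "\<tau> - \<delta> < s" "s < t" "t < \<tau> + \<delta>" for s t
        using \<delta>(2)[rule_format, OF that] \<open>s < t\<close>
        by (simp add: mem_Times_iff \<Lambda>_def zero_le_mult_iff)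
      then have "mono_on ({0..T} \<inter> {\<tau> - \<delta><..<\<tau> + \<delta>}) \<Lambda>"
        by (intro mono_onI) (metis Int_iff greaterThanLessThan_iff order_le_less)
      then show ?thesis using \<delta>(1) by blast
    qed
    show "\<exists>\<delta>>0. mono_on ({0..T} \<inter> {\<tau> - \<delta><..<\<tau> + \<delta>}) (\<lambda>t. - \<Lambda> t)" if "r \<bullet> (g \<tau> + \<Lambda> \<tau> *\<^sub>R b) > 0"
    proof -
      have op: "open {\<xi>. r \<bullet> \<xi> > 0}" by (intro open_Collect_less continuous_intros)
      have "\<xi> \<tau> \<in> {\<xi>. r \<bullet> \<xi> > 0}" using that by (simp add: \<xi>_eq)
      moreover have "closed ((UNIV :: 'a set) \<times> {..0::real})" "convex ((UNIV :: 'a set) \<times> {..0::real})"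
        by (auto intro: closed_Times convex_Times)
      moreover have "V n k \<in> UNIV \<times> {..0}" if "y n (Suc k) \<in> {\<xi>. r \<bullet> \<xi> > 0}" for n k
        using that sign(2)[OF r] by (simp add: V_def)
      ultimately obtain \<delta> where \<delta>: "\<delta> > 0" "\<forall>s\<in>{0..T}. \<forall>t\<in>{0..T}. \<tau> - \<delta> < s \<longrightarrow> s < t \<longrightarrow> t < \<tau> + \<delta> \<longrightarrow>
        (x t - x s) /\<^sub>R (t - s) \<in> UNIV \<times> {..0}"
        using quot[OF \<tau> op] by blast
      have "- \<Lambda> s \<le> - \<Lambda> t" if "s \<in> {0..T}" "t \<in> {0..T}" "\<tau> - \<delta> < s" "s < t" "t < \<tau> + \<delta>" for s t
        using \<delta>(2)[rule_format, OF that] \<open>s < t\<close>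
        by (simp add: mem_Times_iff \<Lambda>_def mult_le_0_iff)
      then have "mono_on ({0..T} \<inter> {\<tau> - \<delta><..<\<tau> + \<delta>}) (\<lambda>t. - \<Lambda> t)"
        by (intro mono_onI) (metis Int_iff greaterThanLessThan_iff order_le_less)
      then show ?thesis using \<delta>(1) by blast
    qed
  qed
qed

section \<open>The complementarity law almost everywhere\<close>

lemma derivative_nonneg_if_locally_mono:
  fixes f :: "real \<Rightarrow> real"
  assumes der: "(f has_vector_derivative \<mu>) (at \<tau> within {0..T})"
    and "\<tau> \<in> {0..T}" "T > 0" "\<delta> > 0"
    and mono: "mono_on ({0..T} \<inter> {\<tau> - \<delta><..<\<tau> + \<delta>}) f"
  shows "\<mu> \<ge> 0"
proof (rule tendsto_lowerbound)
  show "((\<lambda>y. (f y - f \<tau>) / (y - \<tau>)) \<longlongrightarrow> \<mu>) (at \<tau> within {0..T})"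
    using der by (simp add: has_real_derivative_iff_has_vector_derivative[symmetric] has_field_derivative_iff)
  show "at \<tau> within {0..T} \<noteq> bot"
    using assms(2,3) by (simp add: trivial_limit_within islimpt_Icc)
  show "\<forall>\<^sub>F y in at \<tau> within {0..T}. 0 \<le> (f y - f \<tau>) / (y - \<tau>)"
    unfolding eventually_at
  proof (intro exI[of _ \<delta>] conjI ballI impI \<open>\<delta> > 0\<close>)
    fix y assume y: "y \<in> {0..T}" "y \<noteq> \<tau> \<and> dist y \<tau> < \<delta>"
    then have "y \<in> {0..T} \<inter> {\<tau> - \<delta><..<\<tau> + \<delta>}" "\<tau> \<in> {0..T} \<inter> {\<tau> - \<delta><..<\<tau> + \<delta>}"
      using assms(2,4) by (auto simp: dist_real_def abs_less_iff)
    then have "y \<le> \<tau> \<Longrightarrow> f y \<le> f \<tau>" "\<tau> \<le> y \<Longrightarrow> f \<tau> \<le> f y"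
      using mono_onD[OF mono] by blast+
    then show "0 \<le> (f y - f \<tau>) / (y - \<tau>)"
      by (cases "y \<le> \<tau>") (auto simp: zero_le_divide_iff)
  qed
qed

lemma derivative_nonpos_if_locally_antimono:
  fixes f :: "real \<Rightarrow> real"
  assumes der: "(f has_vector_derivative \<mu>) (at \<tau> within {0..T})"
    and "\<tau> \<in> {0..T}" "T > 0" "\<delta> > 0"
    and mono: "mono_on ({0..T} \<inter> {\<tau> - \<delta><..<\<tau> + \<delta>}) (\<lambda>t. - f t)"
  shows "\<mu> \<le> 0"
  using derivative_nonneg_if_locally_mono[OF has_vector_derivative_minus[OF der] assms(2-5)] by simp

text \<open>
  The condition that the push rate \<open>\<mu>\<close> must satisfy at \<open>\<xi>\<close> with respect to the line
  \<open>r \<bullet> \<xi> = 0\<close>, for the vector field value \<open>v\<close>: on the line, the velocity \<open>v + \<mu> *\<^sub>R b\<close> is tangent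
  to it; off the line, the push does not point away from it.
\<close>

definition complementary :: "'a::real_inner \<Rightarrow> 'a \<Rightarrow> 'a \<Rightarrow> real \<Rightarrow> bool" where
  "complementary r \<xi> v \<mu> \<longleftrightarrow>
     (r \<bullet> \<xi> = 0 \<longrightarrow> r \<bullet> v + \<mu> = 0) \<and> (r \<bullet> \<xi> < 0 \<longrightarrow> \<mu> \<ge> 0) \<and> (r \<bullet> \<xi> > 0 \<longrightarrow> \<mu> \<le> 0)"

text \<open>
  Almost every time spent on a boundary line is one where \<open>r \<bullet> \<xi>\<close> has derivative zero. As
  \<open>r \<bullet> \<xi> = r \<bullet> g + \<Lambda>\<close>, this makes \<open>\<Lambda>\<close> differentiable and the velocity tangent to the line. At
  the vertex it holds for both lines. In the interior the two forms have opposite signs, so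
  \<open>\<Lambda>\<close> is both nondecreasing and nonincreasing, hence locally constant. The sign conditions on the push rate are those on the
  derivative of a monotone function.
\<close>

lemma reflected_curve_complementary_ae:
  fixes g :: "real \<Rightarrow> 'a::real_inner" and \<Lambda> :: "real \<Rightarrow> real" and p q b :: 'a and F :: "'a \<Rightarrow> 'a"
  defines "\<xi> \<equiv> \<lambda>t. g t + \<Lambda> t *\<^sub>R b"
  assumes pb: "p \<bullet> b = 1" and qb: "q \<bullet> b = 1" and T: "T > 0"
    and lip: "K-lipschitz_on {0..T} \<xi>"
    and wedge: "\<And>t. t \<in> {0..T} \<Longrightarrow> \<xi> t \<in> double_wedge p q"
    and g': "\<And>t. t \<in> {0..T} \<Longrightarrow> (g has_vector_derivative F (\<xi> t)) (at t within {0..T})"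
    and up: "\<And>r \<tau>. r \<in> {p, q} \<Longrightarrow> \<tau> \<in> {0..T} \<Longrightarrow> r \<bullet> \<xi> \<tau> < 0 \<Longrightarrow>
       \<exists>\<delta>>0. mono_on ({0..T} \<inter> {\<tau> - \<delta><..<\<tau> + \<delta>}) \<Lambda>"
    and down: "\<And>r \<tau>. r \<in> {p, q} \<Longrightarrow> \<tau> \<in> {0..T} \<Longrightarrow> r \<bullet> \<xi> \<tau> > 0 \<Longrightarrow>
       \<exists>\<delta>>0. mono_on ({0..T} \<inter> {\<tau> - \<delta><..<\<tau> + \<delta>}) (\<lambda>t. - \<Lambda> t)"
  shows "negligible {t \<in> {0..T}. \<not> (\<exists>\<mu>.
     (\<xi> has_vector_derivative F (\<xi> t) + \<mu> *\<^sub>R b) (at t within {0..T}) \<and>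
     (\<forall>r\<in>{p, q}. complementary r (\<xi> t) (F (\<xi> t)) \<mu>))}"
proof -
  define N where "N r = {t \<in> {0..T}. r \<bullet> \<xi> t = 0 \<and>
      \<not> ((\<lambda>t. r \<bullet> \<xi> t) has_derivative (\<lambda>_. 0)) (at t within {0..T})}" for r
  have "negligible (N r)" for r
  proof -
    have "(norm r * K)-lipschitz_on {0..T} (\<lambda>t. r \<bullet> \<xi> t)"
    proof (rule lipschitz_onI)
      fix s t assume st: "s \<in> {0..T}" "t \<in> {0..T}"
      have "dist (r \<bullet> \<xi> s) (r \<bullet> \<xi> t) \<le> norm r * dist (\<xi> s) (\<xi> t)"
        using Cauchy_Schwarz_ineq2[of r "\<xi> s - \<xi> t"] by (simp add: dist_norm inner_diff_right)
      also have "\<dots> \<le> norm r * (K * dist s t)"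
        using lipschitz_onD[OF lip st] by (intro mult_left_mono) auto
      finally show "dist (r \<bullet> \<xi> s) (r \<bullet> \<xi> t) \<le> norm r * K * dist s t" by (simp add: mult.assoc)
    qed (use lipschitz_on_nonneg[OF lip] in simp)
    then show ?thesis unfolding N_def by (rule lipschitz_derivative_zero_on_zero_set)
  qed
  then have "negligible (N p \<union> N q)" by (intro negligible_Un)
  moreover have "\<exists>\<mu>. (\<xi> has_vector_derivative F (\<xi> t) + \<mu> *\<^sub>R b) (at t within {0..T}) \<and>
     (\<forall>r\<in>{p, q}. complementary r (\<xi> t) (F (\<xi> t)) \<mu>)"
    if t: "t \<in> {0..T}" "t \<notin> N p \<union> N q" for t
  proof -
    have on_zero: "(\<Lambda> has_vector_derivative - (r \<bullet> F (\<xi> t))) (at t within {0..T})"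
      if r: "r \<in> {p, q}" and "r \<bullet> \<xi> t = 0" for r
    proof -
      have "((\<lambda>t. r \<bullet> \<xi> t) has_vector_derivative 0) (at t within {0..T})"
        using t that unfolding N_def has_vector_derivative_def by auto
      moreover have "((\<lambda>t. r \<bullet> g t) has_vector_derivative r \<bullet> F (\<xi> t)) (at t within {0..T})"
        by (rule bounded_linear.has_vector_derivative[OF bounded_linear_inner_right g'[OF t(1)]])
      ultimately have "((\<lambda>t. r \<bullet> \<xi> t - r \<bullet> g t) has_vector_derivative 0 - r \<bullet> F (\<xi> t)) (at t within {0..T})"
        by (rule has_vector_derivative_diff)
      moreover have "(\<lambda>t. r \<bullet> \<xi> t - r \<bullet> g t) = \<Lambda>"
        using r pb qb by (auto simp: \<xi>_def inner_add_right)
      ultimately show ?thesis by simp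
    qed
    obtain \<mu> where \<mu>: "(\<Lambda> has_vector_derivative \<mu>) (at t within {0..T})"
    proof (cases "p \<bullet> \<xi> t = 0 \<or> q \<bullet> \<xi> t = 0")
      case True
      then show ?thesis using on_zero that by blast
    next
      case False
      moreover have "(p \<bullet> \<xi> t) * (q \<bullet> \<xi> t) \<le> 0" using wedge[OF t(1)] by (simp add: double_wedge_def)
      ultimately have "p \<bullet> \<xi> t < 0 \<and> q \<bullet> \<xi> t > 0 \<or> q \<bullet> \<xi> t < 0 \<and> p \<bullet> \<xi> t > 0"
        by (auto simp: mult_le_0_iff)
      then obtain d e where de: "d > 0" "mono_on ({0..T} \<inter> {t - d<..<t + d}) \<Lambda>"
        "e > 0" "mono_on ({0..T} \<inter> {t - e<..<t + e}) (\<lambda>t. - \<Lambda> t)"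
        using up[of p t] up[of q t] down[of p t] down[of q t] t(1) by blast
      have const: "\<Lambda> t = \<Lambda> s" if "s \<in> {0..T}" "dist s t < min d e" for s
      proof -
        have "s \<in> {0..T} \<inter> {t - d<..<t + d}" "t \<in> {0..T} \<inter> {t - d<..<t + d}"
          "s \<in> {0..T} \<inter> {t - e<..<t + e}" "t \<in> {0..T} \<inter> {t - e<..<t + e}"
          using that t(1) de(1,3) by (auto simp: dist_real_def abs_less_iff)
        then show ?thesis
          using mono_onD[OF de(2), of s t] mono_onD[OF de(2), of t s]
            mono_onD[OF de(4), of s t] mono_onD[OF de(4), of t s] by fastforce
      qed
      have "(\<Lambda> has_vector_derivative 0) (at t within {0..T})"
        by (rule has_vector_derivative_transform_within[OF has_vector_derivative_const, of "min d e"])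
          (use de t(1) const in auto)
      then show ?thesis by (rule that)
    qed
    have "complementary r (\<xi> t) (F (\<xi> t)) \<mu>" if r: "r \<in> {p, q}" for r
      unfolding complementary_def
    proof (intro conjI impI)
      assume "r \<bullet> \<xi> t = 0"
      then have "\<mu> = - (r \<bullet> F (\<xi> t))"
        using vector_derivative_unique_within_closed_interval[of 0 T t \<Lambda> \<mu>] T t(1) \<mu> on_zero[OF r]
        by simp
      then show "r \<bullet> F (\<xi> t) + \<mu> = 0" by simp
    next
      assume "r \<bullet> \<xi> t < 0"
      then show "\<mu> \<ge> 0"
        using up[OF r t(1)] derivative_nonneg_if_locally_mono[OF \<mu> t(1) T] by blast
    next
      assume "r \<bullet> \<xi> t > 0"
      then show "\<mu> \<le> 0"
        using down[OF r t(1)] derivative_nonpos_if_locally_antimono[OF \<mu> t(1) T] by blast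
    qed
    moreover have "(\<xi> has_vector_derivative F (\<xi> t) + \<mu> *\<^sub>R b) (at t within {0..T})"
      unfolding \<xi>_def
      by (intro has_vector_derivative_add g'[OF t(1), unfolded \<xi>_def]
          bounded_linear.has_vector_derivative[OF bounded_linear_scaleR_left \<mu>])
    ultimately show ?thesis by blast
  qed
  ultimately show ?thesis by (elim negligible_subset) blast
qed

section \<open>Tangent cones and the projection operator\<close>

lemma tangent_cone_if_ray:
  assumes "\<delta> > 0" and ray: "\<And>\<tau>. 0 < \<tau> \<Longrightarrow> \<tau> < \<delta> \<Longrightarrow> \<xi> + \<tau> *\<^sub>R w \<in> C"
  shows "w \<in> tangent_cone C \<xi>"
proof -
  define \<tau> where "\<tau> i = \<delta> / 2 * inverse (real (Suc i))" for i
  have pos: "\<tau> i > 0" for i using \<open>\<delta> > 0\<close> by (simp add: \<tau>_def)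
  have "inverse (real (Suc i)) \<le> 1" for i by (simp add: field_simps)
  then have "\<tau> i \<le> \<delta> / 2 * 1" for i
    unfolding \<tau>_def using \<open>\<delta> > 0\<close> by (intro mult_left_mono) auto
  then have small: "\<tau> i < \<delta>" for i using \<open>\<delta> > 0\<close> by (smt (verit) field_sum_of_halves)
  have lim: "\<tau> \<longlonglongrightarrow> 0"
    unfolding \<tau>_def by (rule tendsto_mult_right_zero[OF LIMSEQ_inverse_real_of_nat])
  have "decseq \<tau>"
    unfolding \<tau>_def using \<open>\<delta> > 0\<close>
    by (intro decseq_SucI mult_left_mono le_imp_inverse_le) auto
  moreover have "(\<lambda>i. \<xi> + \<tau> i *\<^sub>R w) \<longlonglongrightarrow> \<xi>"
    using tendsto_add[OF tendsto_const tendsto_scaleR[OF lim tendsto_const], of \<xi> w] by simp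
  moreover have "(\<lambda>i. (\<xi> + \<tau> i *\<^sub>R w - \<xi>) /\<^sub>R \<tau> i) = (\<lambda>i. w)"
    using pos by (auto simp: less_le)
  ultimately show ?thesis
    unfolding tangent_cone_def using pos small ray lim
    by (intro CollectI exI[of _ "\<lambda>i. \<xi> + \<tau> i *\<^sub>R w"] exI[of _ \<tau>]) auto
qed

text \<open>
  For points \<open>X i\<close> of the wedge tending to \<open>\<xi>\<close>, divide \<open>(p \<bullet> X i) * (q \<bullet> X i) \<le> 0\<close> by the step
  length once for each form that vanishes at \<open>\<xi>\<close>, and pass to the limit.
\<close>

lemma tangent_double_wedge_edge:
  assumes "w \<in> tangent_cone (double_wedge p q) \<xi>" "p \<bullet> \<xi> = 0"
  shows "(p \<bullet> w) * (q \<bullet> \<xi>) \<le> 0"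
    and "q \<bullet> \<xi> = 0 \<Longrightarrow> (p \<bullet> w) * (q \<bullet> w) \<le> 0"
proof -
  obtain X \<tau> where X: "\<And>i. X i \<in> double_wedge p q" "X \<longlonglongrightarrow> \<xi>" and \<tau>: "\<And>i. \<tau> i > 0"
    and w: "(\<lambda>i. (X i - \<xi>) /\<^sub>R \<tau> i) \<longlonglongrightarrow> w"
    using assms(1) unfolding tangent_cone_def by blast
  have rw: "(\<lambda>i. r \<bullet> ((X i - \<xi>) /\<^sub>R \<tau> i)) \<longlonglongrightarrow> r \<bullet> w" for r
    by (intro tendsto_intros w)
  have eq: "r \<bullet> ((X i - \<xi>) /\<^sub>R \<tau> i) = inverse (\<tau> i) * (r \<bullet> X i)" if "r \<bullet> \<xi> = 0" for r i
    using that by (simp add: inner_diff_right)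
  have le: "(p \<bullet> X i) * (q \<bullet> X i) \<le> 0" for i
    using X(1) by (simp add: double_wedge_def)
  have "(\<lambda>i. p \<bullet> ((X i - \<xi>) /\<^sub>R \<tau> i) * (q \<bullet> X i)) \<longlonglongrightarrow> (p \<bullet> w) * (q \<bullet> \<xi>)"
    by (intro tendsto_mult rw tendsto_intros X(2))
  moreover have "p \<bullet> ((X i - \<xi>) /\<^sub>R \<tau> i) * (q \<bullet> X i) \<le> 0" for i
    unfolding eq[OF assms(2)] mult.assoc using \<tau>[of i] le[of i]
    by (simp add: mult_le_0_iff)
  ultimately show "(p \<bullet> w) * (q \<bullet> \<xi>) \<le> 0" by (intro LIMSEQ_le_const2) auto
  assume q: "q \<bullet> \<xi> = 0"
  have "(\<lambda>i. p \<bullet> ((X i - \<xi>) /\<^sub>R \<tau> i) * (q \<bullet> ((X i - \<xi>) /\<^sub>R \<tau> i))) \<longlonglongrightarrow> (p \<bullet> w) * (q \<bullet> w)"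
    by (intro tendsto_mult rw)
  moreover have "p \<bullet> ((X i - \<xi>) /\<^sub>R \<tau> i) * (q \<bullet> ((X i - \<xi>) /\<^sub>R \<tau> i)) \<le> 0" for i
  proof -
    have "p \<bullet> ((X i - \<xi>) /\<^sub>R \<tau> i) * (q \<bullet> ((X i - \<xi>) /\<^sub>R \<tau> i)) =
        (inverse (\<tau> i) * inverse (\<tau> i)) * ((p \<bullet> X i) * (q \<bullet> X i))"
      unfolding eq[OF assms(2)] eq[OF q] by simp
    also have "\<dots> \<le> 0" by (rule mult_nonneg_nonpos[OF zero_le_square le])
    finally show ?thesis .
  qed
  ultimately show "(p \<bullet> w) * (q \<bullet> w) \<le> 0" by (intro LIMSEQ_le_const2) auto
qed

lemma double_wedge_commute: "double_wedge p q = double_wedge q p"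
  by (simp add: double_wedge_def mult.commute)

lemma complementary_imp_tangent:
  assumes \<xi>: "\<xi> \<in> double_wedge p q"
    and w: "\<And>r. r \<in> {p, q} \<Longrightarrow> r \<bullet> \<xi> = 0 \<Longrightarrow> r \<bullet> w = 0"
  shows "w \<in> tangent_cone (double_wedge p q) \<xi>"
proof (cases "p \<bullet> \<xi> = 0 \<or> q \<bullet> \<xi> = 0")
  case True
  then show ?thesis
    using w by (intro tangent_cone_if_ray[of 1]) (auto simp: double_wedge_def inner_add_right)
next
  case False
  define f where "f \<tau> = (p \<bullet> (\<xi> + \<tau> *\<^sub>R w)) * (q \<bullet> (\<xi> + \<tau> *\<^sub>R w))" for \<tau>
  have "f 0 < 0" using False \<xi> by (auto simp: f_def double_wedge_def less_le)
  moreover have "isCont f 0" unfolding f_def by (intro continuous_intros)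
  ultimately have "\<forall>\<^sub>F \<tau> in at 0. f \<tau> < 0"
    using order_tendstoD(2) isContD by blast
  then obtain d where "d > 0" "\<And>\<tau>. \<tau> \<noteq> 0 \<Longrightarrow> dist \<tau> 0 < d \<Longrightarrow> f \<tau> < 0"
    unfolding eventually_at by blast
  then show ?thesis
    by (intro tangent_cone_if_ray[of d]) (auto simp: f_def double_wedge_def less_imp_le)
qed

text \<open>
  If \<open>\<mu> \<noteq> 0\<close>, then \<open>\<xi>\<close> lies on one of the lines, say \<open>r \<bullet> \<xi> = 0\<close>, and any competing push \<open>\<nu>\<close>
  gives \<open>r \<bullet> w = \<nu> - \<mu>\<close>. On a single face, tangency of \<open>w\<close> then forces \<open>\<nu>\<close> to be at least as
  large as \<open>\<mu>\<close> in the direction of \<open>\<mu>\<close>; at the vertex it gives \<open>(\<nu> - \<mu>)\<^sup>2 \<le> 0\<close>.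
\<close>

lemma complementary_push_minimal:
  assumes \<xi>: "\<xi> \<in> double_wedge p q"
    and w: "w \<in> tangent_cone (double_wedge p q) \<xi>"
    and comp: "complementary p \<xi> v \<mu>" "complementary q \<xi> v \<mu>"
    and pw: "p \<bullet> w = p \<bullet> v + \<nu>" and qw: "q \<bullet> w = q \<bullet> v + \<nu>"
  shows "\<bar>\<mu>\<bar> \<le> \<bar>\<nu>\<bar> \<and> (\<bar>\<nu>\<bar> = \<bar>\<mu>\<bar> \<longrightarrow> \<nu> = \<mu>)"
proof (cases "\<mu> = 0")
  case False
  have edge: ?thesis if r: "r \<bullet> \<xi> = 0" "complementary r \<xi> v \<mu>" "complementary r' \<xi> v \<mu>"
    "r \<bullet> w = r \<bullet> v + \<nu>" "r' \<bullet> w = r' \<bullet> v + \<nu>" "w \<in> tangent_cone (double_wedge r r') \<xi>" for r r'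
  proof -
    have rw: "r \<bullet> w = \<nu> - \<mu>" using r by (auto simp: complementary_def)
    have "(\<nu> - \<mu>) * (r' \<bullet> \<xi>) \<le> 0"
      using tangent_double_wedge_edge(1)[OF r(6,1)] rw by simp
    moreover have "\<nu> = \<mu>" if "r' \<bullet> \<xi> = 0"
    proof -
      have "r' \<bullet> w = \<nu> - \<mu>" using r that by (auto simp: complementary_def)
      then show ?thesis using tangent_double_wedge_edge(2)[OF r(6,1) that] rw
        by (auto simp: mult_le_0_iff)
    qed
    ultimately show ?thesis
      using r(3) False unfolding complementary_def
      by (cases "r' \<bullet> \<xi>" "0::real" rule: linorder_cases) (auto simp: mult_le_0_iff)
  qed
  have "p \<bullet> \<xi> = 0 \<or> q \<bullet> \<xi> = 0"
    using \<xi> comp False by (auto simp: double_wedge_def complementary_def mult_le_0_iff)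
  then show ?thesis
    using edge[of p q] edge[of q p] comp pw qw w by (auto simp: double_wedge_commute[of q p])
qed auto

text \<open>
  A correction in \<open>E\<close> acts on the two forms only through its component along \<open>b\<close>, and the component
  orthogonal to \<open>b\<close> only lengthens it. Hence the minimization reduces to the scalar push, where the
  complementarity law characterizes the unique minimizer.
\<close>

lemma proj_operator_double_wedge:
  assumes b: "norm b = 1" and E: "\<And>c. c *\<^sub>R b \<in> E" "\<And>d. d \<in> E \<Longrightarrow> p \<bullet> d = b \<bullet> d \<and> q \<bullet> d = b \<bullet> d"
    and \<xi>: "\<xi> \<in> double_wedge p q"
    and comp: "complementary p \<xi> v \<mu>" "complementary q \<xi> v \<mu>"
  shows "proj_operator (double_wedge p q) E \<xi> v = v + \<mu> *\<^sub>R b"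
proof -
  let ?T = "tangent_cone (double_wedge p q) \<xi>"
  have bb: "b \<bullet> b = 1" using b by (simp add: dot_square_norm)
  have "b \<in> E" using E(1)[of 1] by simp
  then have "p \<bullet> b = 1" "q \<bullet> b = 1" using E(2) bb by auto
  then have T: "v + \<mu> *\<^sub>R b \<in> ?T"
    using comp by (intro complementary_imp_tangent[OF \<xi>]) (auto simp: complementary_def inner_add_right)
  have min: "\<bar>\<mu>\<bar> \<le> norm (w - v) \<and> (norm (w - v) = \<bar>\<mu>\<bar> \<longrightarrow> w = v + \<mu> *\<^sub>R b)"
    if w: "w \<in> ?T" "w - v \<in> E" for w
  proof -
    define \<nu> where "\<nu> = b \<bullet> (w - v)"
    have "p \<bullet> w = p \<bullet> v + \<nu>" "q \<bullet> w = q \<bullet> v + \<nu>"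
      using E(2)[OF w(2)] by (auto simp: \<nu>_def inner_diff_right)
    then have m: "\<bar>\<mu>\<bar> \<le> \<bar>\<nu>\<bar>" "\<bar>\<nu>\<bar> = \<bar>\<mu>\<bar> \<Longrightarrow> \<nu> = \<mu>"
      using complementary_push_minimal[OF \<xi> w(1) comp] by auto
    have \<nu>: "\<bar>\<nu>\<bar> \<le> norm (w - v)"
      using Cauchy_Schwarz_ineq2[of b "w - v"] b by (simp add: \<nu>_def)
    have "w = v + \<mu> *\<^sub>R b" if "norm (w - v) = \<bar>\<mu>\<bar>"
    proof -
      have "\<nu> = \<mu>" using m \<nu> that by simp
      have "(norm (w - v - \<mu> *\<^sub>R b))\<^sup>2 = (norm (w - v))\<^sup>2 - 2 * \<mu> * \<nu> + \<mu>\<^sup>2"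
        using dot_norm_neg[of "w - v" "\<mu> *\<^sub>R b"] b
        by (simp add: \<nu>_def inner_commute power_mult_distrib)
      also have "\<dots> = 0" using that \<open>\<nu> = \<mu>\<close> by (simp add: power2_eq_square)
      finally show ?thesis by (simp add: algebra_simps)
    qed
    then show ?thesis using m(1) \<nu> by linarith
  qed
  have norm_push: "norm (v + \<mu> *\<^sub>R b - v) = \<bar>\<mu>\<bar>" using b by simp
  have feasible: "v + \<mu> *\<^sub>R b \<in> ?T \<and> v + \<mu> *\<^sub>R b - v \<in> E" using T E(1) by simp
  show ?thesis
    unfolding proj_operator_def
  proof (rule the_equality)
    show "is_arg_min (\<lambda>w. norm (w - v)) (\<lambda>w. w \<in> ?T \<and> w - v \<in> E) (v + \<mu> *\<^sub>R b)"
      unfolding is_arg_min_def norm_push using feasible min not_less by blast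
    fix w assume "is_arg_min (\<lambda>w. norm (w - v)) (\<lambda>w. w \<in> ?T \<and> w - v \<in> E) w"
    then have w: "w \<in> ?T" "w - v \<in> E" "norm (w - v) \<le> \<bar>\<mu>\<bar>"
      using feasible unfolding is_arg_min_def norm_push[symmetric] not_less[symmetric] by blast+
    then show "w = v + \<mu> *\<^sub>R b"
      using min[OF w(1,2)] by (simp only: order_antisym)
  qed
qed

section \<open>Existence of solutions\<close>

lemma lipschitz_imp_abs_continuous_on:
  assumes lip: "L-lipschitz_on {a..b} g"
  shows "abs_continuous_on a b g"
  unfolding abs_continuous_on_def
proof (intro allI impI)
  fix \<epsilon> :: real assume "\<epsilon> > 0"
  have L: "L \<ge> 0" using lip by (rule lipschitz_on_nonneg)
  show "\<exists>\<delta>>0. \<forall>D. finite D \<and> (\<forall>(c, d)\<in>D. a \<le> c \<and> c \<le> d \<and> d \<le> b) \<and>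
      pairwise (\<lambda>p q. disjnt {fst p<..<snd p} {fst q<..<snd q}) D \<and>
      (\<Sum>(c, d)\<in>D. d - c) < \<delta> \<longrightarrow> (\<Sum>(c, d)\<in>D. norm (g d - g c)) < \<epsilon>"
  proof (intro exI conjI allI impI)
    show "\<epsilon> / (L + 1) > 0" using L \<open>\<epsilon> > 0\<close> by simp
    fix D :: "(real \<times> real) set"
    assume D: "finite D \<and> (\<forall>(c, d)\<in>D. a \<le> c \<and> c \<le> d \<and> d \<le> b) \<and>
      pairwise (\<lambda>p q. disjnt {fst p<..<snd p} {fst q<..<snd q}) D \<and>
      (\<Sum>(c, d)\<in>D. d - c) < \<epsilon> / (L + 1)"
    have "(\<Sum>(c, d)\<in>D. norm (g d - g c)) \<le> (\<Sum>(c, d)\<in>D. (L + 1) * (d - c))"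
    proof (rule sum_mono, clarify)
      fix c d assume "(c, d) \<in> D"
      then have cd: "a \<le> c" "c \<le> d" "d \<le> b" using D by auto
      then have "norm (g d - g c) \<le> L * (d - c)"
        using lipschitz_onD[OF lip, of d c] by (simp add: dist_norm)
      also have "\<dots> \<le> (L + 1) * (d - c)" using cd by (intro mult_right_mono) auto
      finally show "norm (g d - g c) \<le> (L + 1) * (d - c)" .
    qed
    also have "\<dots> = (L + 1) * (\<Sum>(c, d)\<in>D. d - c)"
      by (simp add: sum_distrib_left case_prod_unfold)
    also have "\<dots> < \<epsilon>" using D L by (simp add: pos_less_divide_eq mult.commute)
    finally show "(\<Sum>(c, d)\<in>D. norm (g d - g c)) < \<epsilon>" .
  qed
qed

text \<open>
  The vector field is made bounded by composing it with the projection onto the unit ball around the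
  initial state. The Lipschitz constant of the resulting curve tells how long it stays in that ball,
  where the modified field agrees with the original one.
\<close>

lemma caratheodory_solution_double_wedge:
  fixes p q b \<xi>\<^sub>0 :: "'a::euclidean_space" and F :: "'a \<Rightarrow> 'a"
  assumes b: "norm b = 1" and E: "\<And>c. c *\<^sub>R b \<in> E" "\<And>d. d \<in> E \<Longrightarrow> p \<bullet> d = b \<bullet> d \<and> q \<bullet> d = b \<bullet> d"
    and F: "continuous_on UNIV F" and \<xi>\<^sub>0: "\<xi>\<^sub>0 \<in> double_wedge p q"
  shows "\<exists>T>0. \<exists>\<xi>. \<xi> 0 = \<xi>\<^sub>0 \<and> caratheodory_solution (double_wedge p q) E F T \<xi>"
proof -
  have "b \<in> E" using E(1)[of 1] by simp
  then have pb: "p \<bullet> b = 1" and qb: "q \<bullet> b = 1" using E(2) b by (auto simp: dot_square_norm)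
  define B where "B = cball \<xi>\<^sub>0 1"
  have B: "convex B" "closed B" "compact B" "B \<noteq> {}" by (auto simp: B_def)
  define F' where "F' = F \<circ> closest_point B"
  have cont: "continuous_on UNIV F'"
    unfolding F'_def using continuous_on_closest_point[OF B(1,2,4)] F
    by (intro continuous_on_compose continuous_on_subset[OF F]) auto
  have "bounded (F ` B)"
    using compact_continuous_image[OF continuous_on_subset[OF F] B(3)] compact_imp_bounded by blast
  then obtain M where M: "\<And>\<xi>. \<xi> \<in> B \<Longrightarrow> norm (F \<xi>) \<le> M" unfolding bounded_iff by blast
  have M': "norm (F' \<xi>) \<le> M" for \<xi>
    using M closest_point_in_set[OF B(2,4)] by (simp add: F'_def)
  obtain g \<Lambda> L where
    init: "g 0 = \<xi>\<^sub>0" "\<Lambda> 0 = 0"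
    and lip: "L-lipschitz_on {0..1} g" "L-lipschitz_on {0..1} \<Lambda>"
    and wedge: "\<And>t. t \<in> {0..1} \<Longrightarrow> g t + \<Lambda> t *\<^sub>R b \<in> double_wedge p q"
    and g': "\<And>t. t \<in> {0..1} \<Longrightarrow> (g has_vector_derivative F' (g t + \<Lambda> t *\<^sub>R b)) (at t within {0..1})"
    and up: "\<And>r \<tau>. r \<in> {p, q} \<Longrightarrow> \<tau> \<in> {0..1} \<Longrightarrow> r \<bullet> (g \<tau> + \<Lambda> \<tau> *\<^sub>R b) < 0 \<Longrightarrow>
       \<exists>\<delta>>0. mono_on ({0..1} \<inter> {\<tau> - \<delta><..<\<tau> + \<delta>}) \<Lambda>"
    and down: "\<And>r \<tau>. r \<in> {p, q} \<Longrightarrow> \<tau> \<in> {0..1} \<Longrightarrow> r \<bullet> (g \<tau> + \<Lambda> \<tau> *\<^sub>R b) > 0 \<Longrightarrow>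
       \<exists>\<delta>>0. mono_on ({0..1} \<inter> {\<tau> - \<delta><..<\<tau> + \<delta>}) (\<lambda>t. - \<Lambda> t)"
    using reflected_curve_exists[where F=F' and T=1, OF pb qb M' cont \<xi>\<^sub>0 zero_less_one] by blast
  define \<xi> where "\<xi> = (\<lambda>t. g t + \<Lambda> t *\<^sub>R b)"
  have L: "L \<ge> 0" using lip(1) by (rule lipschitz_on_nonneg)
  have \<xi>_lip: "(2 * L)-lipschitz_on {0..1} \<xi>"
  proof (rule lipschitz_onI)
    fix s t :: real assume st: "s \<in> {0..1}" "t \<in> {0..1}"
    have "dist (\<xi> s) (\<xi> t) \<le> dist (g s) (g t) + dist (\<Lambda> s *\<^sub>R b) (\<Lambda> t *\<^sub>R b)"
      unfolding \<xi>_def by (rule dist_triangle_add)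
    also have "dist (\<Lambda> s *\<^sub>R b) (\<Lambda> t *\<^sub>R b) = dist (\<Lambda> s) (\<Lambda> t)"
      using b by (simp add: dist_norm scaleR_diff_left[symmetric])
    also have "dist (g s) (g t) + dist (\<Lambda> s) (\<Lambda> t) \<le> 2 * L * dist s t"
      using lipschitz_onD[OF lip(1) st] lipschitz_onD[OF lip(2) st] by simp
    finally show "dist (\<xi> s) (\<xi> t) \<le> 2 * L * dist s t" by simp
  qed (use L in simp)
  define T where "T = 1 / (2 * L + 1)"
  have T: "0 < T" "T \<le> 1" using L by (auto simp: T_def)
  have "2 * L * T \<le> 1" using L by (simp add: T_def divide_le_eq_1)
  have stay: "\<xi> t \<in> B" if "t \<in> {0..T}" for t
  proof -
    have "dist (\<xi> 0) (\<xi> t) \<le> 2 * L * dist 0 t"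
      using that T by (intro lipschitz_onD[OF \<xi>_lip]) auto
    also have "\<dots> \<le> 2 * L * T" using that L by (intro mult_left_mono) auto
    finally show ?thesis
      using \<open>2 * L * T \<le> 1\<close> by (simp add: B_def \<xi>_def init)
  qed
  define Bad where "Bad = {t \<in> {0..1}. \<not> (\<exists>\<mu>.
     (\<xi> has_vector_derivative F' (\<xi> t) + \<mu> *\<^sub>R b) (at t within {0..1}) \<and>
     (\<forall>r\<in>{p, q}. complementary r (\<xi> t) (F' (\<xi> t)) \<mu>))}"
  have "negligible Bad"
    unfolding Bad_def \<xi>_def
    by (rule reflected_curve_complementary_ae[OF pb qb zero_less_one \<xi>_lip[unfolded \<xi>_def] wedge g' up down])
  moreover have "(\<xi> has_vector_derivative proj_operator (double_wedge p q) E (\<xi> t) (F (\<xi> t)))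
      (at t within {0..T})" if t: "t \<in> {0..T}" "t \<notin> Bad" for t
  proof -
    have "t \<in> {0..1}" using t T by simp
    then obtain \<mu> where \<mu>: "(\<xi> has_vector_derivative F' (\<xi> t) + \<mu> *\<^sub>R b) (at t within {0..1})"
      "complementary p (\<xi> t) (F' (\<xi> t)) \<mu>" "complementary q (\<xi> t) (F' (\<xi> t)) \<mu>"
      using t(2) unfolding Bad_def by blast
    have "F' (\<xi> t) = F (\<xi> t)"
      using stay[OF t(1)] by (simp add: F'_def closest_point_self)
    moreover have "proj_operator (double_wedge p q) E (\<xi> t) (F' (\<xi> t)) = F' (\<xi> t) + \<mu> *\<^sub>R b"
      using wedge[OF \<open>t \<in> {0..1}\<close>] \<mu>(2,3)
      by (intro proj_operator_double_wedge[OF b E]) (auto simp: \<xi>_def)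
    ultimately show ?thesis
      using has_vector_derivative_within_subset[OF \<mu>(1), of "{0..T}"] T by simp
  qed
  ultimately have "AE t in lebesgue_on {0..T}.
      (\<xi> has_vector_derivative proj_operator (double_wedge p q) E (\<xi> t) (F (\<xi> t))) (at t within {0..T})"
    by (subst AE_restrict_space_iff) (auto simp: negligible_iff_null_sets intro!: AE_I'[of Bad])
  moreover have "abs_continuous_on 0 T \<xi>"
    using T by (intro lipschitz_imp_abs_continuous_on[OF lipschitz_on_subset[OF \<xi>_lip]]) auto
  moreover have "\<xi> t \<in> double_wedge p q" if "t \<in> {0..T}" for t
    using wedge[of t] that T by (simp add: \<xi>_def)
  ultimately show ?thesis
    using T(1) init unfolding caratheodory_solution_def by (intro exI[of _ T] conjI exI[of _ \<xi>]) (auto simp: \<xi>_def)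
qed

theorem theorem8:
  fixes f\<^sub>p :: "(real ^ 'n) \<times> real \<Rightarrow> real ^ 'n"
    and f\<^sub>c :: "(real ^ 'm::{finite,linorder}) \<times> real \<Rightarrow> real ^ 'm::{finite,linorder}"
    and G\<^sub>p :: "real ^ 'n ^ 1"
    and k\<^sub>1 k\<^sub>2 :: real
    and \<xi>\<^sub>0 :: "(real ^ 'n) \<times> (real ^ 'm::{finite,linorder})"
  assumes "continuous_on UNIV f\<^sub>p"
    and "continuous_on UNIV f\<^sub>c"
    and "k\<^sub>1 < k\<^sub>2"
    and "\<xi>\<^sub>0 \<in> sector_states G\<^sub>p k\<^sub>1 k\<^sub>2"
  shows "\<exists>T>0. \<exists>\<xi>. \<xi> 0 = \<xi>\<^sub>0 \<and>
           caratheodory_solution (sector_states G\<^sub>p k\<^sub>1 k\<^sub>2) proj_directions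
             (closed_loop f\<^sub>p f\<^sub>c G\<^sub>p) T \<xi>"
proof -
  \<comment> \<open>\<open>b\<close> represents the controller output \<open>u\<close> and \<open>c\<close> the plant output \<open>e\<close>; the sector is bounded
     by \<open>u = k\<^sub>1 * e\<close> and \<open>u = k\<^sub>2 * e\<close>.\<close>
  define b :: "(real ^ 'n) \<times> (real ^ 'm::{finite,linorder})" where "b = (0, axis (Min UNIV) 1)"
  define c :: "(real ^ 'n) \<times> (real ^ 'm::{finite,linorder})" where "c = (G\<^sub>p $ 1, 0)"
  have u: "b \<bullet> w = first_comp (snd w)" for w
    by (simp add: first_comp_def b_def inner_prod_def inner_axis')
  have e: "c \<bullet> w = row_apply G\<^sub>p (fst w)" for w
    by (simp add: row_apply_def c_def inner_prod_def matrix_vector_mul_component)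
  have S: "sector_states G\<^sub>p k\<^sub>1 k\<^sub>2 = double_wedge (b - k\<^sub>1 *\<^sub>R c) (b - k\<^sub>2 *\<^sub>R c)"
    by (simp add: sector_states_def sector_def double_wedge_def inner_diff_left u e case_prod_beta')
  have "continuous_on UNIV (closed_loop f\<^sub>p f\<^sub>c G\<^sub>p)"
  proof -
    have "closed_loop f\<^sub>p f\<^sub>c G\<^sub>p = (\<lambda>w. (f\<^sub>p (fst w, b \<bullet> w), f\<^sub>c (snd w, c \<bullet> w)))"
      by (simp add: closed_loop_def u e case_prod_beta')
    moreover have "continuous_on UNIV (\<lambda>w. f\<^sub>p (fst w, b \<bullet> w))"
      by (rule continuous_on_compose2[OF assms(1)]) (auto intro!: continuous_intros)
    moreover have "continuous_on UNIV (\<lambda>w. f\<^sub>c (snd w, c \<bullet> w))"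
      by (rule continuous_on_compose2[OF assms(2)]) (auto intro!: continuous_intros)
    ultimately show ?thesis by (simp add: continuous_on_Pair)
  qed
  moreover have "norm b = 1"
    by (simp add: b_def norm_Pair)
  moreover have "s *\<^sub>R b \<in> proj_directions" for s
    by (simp add: b_def proj_directions_def)
  moreover have "(b - k *\<^sub>R c) \<bullet> d = b \<bullet> d" if "d \<in> proj_directions" for d k
    using that by (auto simp: c_def proj_directions_def inner_diff_left)
  ultimately show ?thesis
    using assms(4) unfolding S by (intro caratheodory_solution_double_wedge[where b = b]) auto
qed

end
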